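(* Let $J=\begin{pmatrix}0&0&1\\0&1&0\\1&0&0\end{pmatrix}$, let $\mathcal{O}_7$ be the ring of integers of $\mathbb{Q}(i\sqrt7)$, and let $\Gamma=PU(J,\mathcal{O}_7)$. Let $\Gamma_0\subset\Gamma$ be the kernel of reduction modulo the ideal $\langle i\sqrt7\rangle\subset\mathcal{O}_7$ (whose residue ring is $\mathbb{F}_7$), i.e. the subgroup of elements of $\Gamma$ having a matrix representative in $U(J,\mathcal{O}_7)$ that is congruent to the identity matrix modulo $\langle i\sqrt7\rangle$. Then $\Gamma_0$ is a torsion-free subgroup of index $336$ in $\Gamma$, which is torsion-free at infinity as well.
   Context: With $\langle v,w\rangle=w^*Jv$ on $\mathbb{C}^3$ (a Hermitian form of signature $(2,1)$), $U(J)$ is the group of complex $3\times 3$ matrices preserving this form, $U(J,\mathcal{O}_7)=U(J)\cap GL(3,\mathcal{O}_7)$, and $PU(J,\mathcal{O}_7)=U(J,\mathcal{O}_7)/\{\pm Id\}$; it acts on the complex hyperbolic plane $H^2_{\mathbb{C}}$, the set of complex lines in $\mathbb{C}^3$ spanned by vectors $v$ with $\langle v,v\rangle<0$. An isometry is parabolic if it fixes no point of $H^2_{\mathbb{C}}$ and exactly one point of the boundary at infinity (complex lines spanned by non-zero null vectors); it is unipotent if it has a unipotent matrix representative. A subgroup of $\Gamma$ is torsion-free at infinity if each of its parabolic elements is unipotent. *)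

theory Defs
  imports "HOL-Analysis.Analysis" "HOL-Algebra.Coset"
begin

definition Jmat :: "complex^3^3" where
  "Jmat = vector [vector [0, 0, 1], vector [0, 1, 0], vector [1, 0, 0]]"

text \<open>The form \<open>w\<^sup>* J v\<close>: linear in the first argument, conjugate-linear in the second.\<close>
definition herm :: "complex^3 \<Rightarrow> complex^3 \<Rightarrow> complex" where
  "herm v w = (\<Sum>i\<in>UNIV. cnj (w $ i) * (Jmat *v v) $ i)"

definition UJ :: "(complex^3^3) set" where
  "UJ = {A. \<forall>v w. herm (A *v v) (A *v w) = herm v w}"

definition isqrt7 :: complex where
  "isqrt7 = \<i> * of_real (sqrt 7)"

definition Q_isqrt7 :: "complex set" where
  "Q_isqrt7 = {of_rat a + of_rat b * isqrt7 |a b. True}"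

definition O7 :: "complex set" where
  "O7 = {z \<in> Q_isqrt7. algebraic_int z}"

definition ideal_isqrt7 :: "complex set" where
  "ideal_isqrt7 = {isqrt7 * z |z. z \<in> O7}"

definition mats_O7 :: "(complex^3^3) set" where
  "mats_O7 = {A. \<forall>i j. A $ i $ j \<in> O7}"

definition GL3_O7 :: "(complex^3^3) set" where
  "GL3_O7 = {A \<in> mats_O7. \<exists>B\<in>mats_O7. A ** B = mat 1 \<and> B ** A = mat 1}"

definition UJ_O7 :: "(complex^3^3) monoid" where
  "UJ_O7 = \<lparr>carrier = UJ \<inter> GL3_O7, monoid.mult = (\<lambda>A B. A ** B), one = mat 1\<rparr>"

text \<open>An element of the quotient is a coset \<open>{A, - A}\<close>, i.e. the set of its matrix
  representatives in \<^term>\<open>UJ_O7\<close>.\<close>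
definition PUJ_O7 :: "(complex^3^3) set monoid" where
  "PUJ_O7 = UJ_O7 Mod {mat 1, - mat 1}"

definition cong_id :: "complex^3^3 \<Rightarrow> bool" where
  "cong_id A \<longleftrightarrow> (\<forall>i j. (A - mat 1) $ i $ j \<in> ideal_isqrt7)"

definition Gamma0 :: "(complex^3^3) set set" where
  "Gamma0 = {g \<in> carrier PUJ_O7. \<exists>A\<in>g. cong_id A}"

text \<open>Points are complex lines \<open>vec.span {v}\<close>, where \<^term>\<open>vec.span\<close> is the span with respect
  to complex scalars. The number \<^term>\<open>herm v v\<close> is always real.\<close>
definition H2C :: "(complex^3) set set" where
  "H2C = {vec.span {v} |v. Re (herm v v) < 0}"

definition boundary_H2C :: "(complex^3) set set" where
  "boundary_H2C = {vec.span {v} |v. v \<noteq> 0 \<and> herm v v = 0}"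

text \<open>The representatives \<open>A\<close> and \<open>- A\<close> map a line to the same line, so the union is just
  the common image.\<close>
definition act :: "(complex^3^3) set \<Rightarrow> (complex^3) set \<Rightarrow> (complex^3) set" where
  "act g L = (\<Union>A\<in>g. (\<lambda>v. A *v v) ` L)"

definition parabolic :: "(complex^3^3) set \<Rightarrow> bool" where
  "parabolic g \<longleftrightarrow>
     (\<forall>L\<in>H2C. act g L \<noteq> L) \<and> (\<exists>!L. L \<in> boundary_H2C \<and> act g L = L)"

text \<open>The \<open>n\<close>-th matrix power is an iterated \<open>**\<close>, because \<open>^\<close> on \<open>complex^3^3\<close> is
  the entrywise power.\<close>
definition unipotent_mat :: "complex^3^3 \<Rightarrow> bool" where
  "unipotent_mat A \<longleftrightarrow> (\<exists>n. ((\<lambda>B. (A - mat 1) ** B) ^^ n) (mat 1) = 0)"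

definition unipotent :: "(complex^3^3) set \<Rightarrow> bool" where
  "unipotent g \<longleftrightarrow> (\<exists>A\<in>g. unipotent_mat A)"

definition torsion_free :: "('a, 'b) monoid_scheme \<Rightarrow> 'a set \<Rightarrow> bool" where
  "torsion_free G H \<longleftrightarrow>
     (\<forall>h\<in>H. \<forall>n::nat. n > 0 \<longrightarrow> h [^]\<^bsub>G\<^esub> n = \<one>\<^bsub>G\<^esub> \<longrightarrow> h = \<one>\<^bsub>G\<^esub>)"

definition torsion_free_at_infinity :: "(complex^3^3) set set \<Rightarrow> bool" where
  "torsion_free_at_infinity H \<longleftrightarrow> (\<forall>h\<in>H. parabolic h \<longrightarrow> unipotent h)"

end

theory Submission
  imports Defs
begin

text \<open>Write \<open>\<pi> = i \<surd>7\<close>. Complex conjugation is trivial modulo \<open>\<pi>\<close>, so reduction maps \<open>U(J, O\<^sub>7)\<close> to the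
  orthogonal group of \<open>J\<close> over the field with 7 elements. A matrix of determinant 1 in that group is
  determined by its first and third columns, which are isotropic with product 1; there are 336
  such pairs. All of them lift, because Heisenberg translations, the Weyl element and
  \<open>diag(-1, 1, -1)\<close> lift and they generate, by the Bruhat decomposition.

  If \<open>A \<equiv> 1\<close> has \<open>A\<^sup>n = 1\<close>, then \<open>(1 + A + \<dots> + A\<^sup>n\<^sup>-\<^sup>1) (A - 1) = 0\<close>, and up to a power of
  \<open>\<pi>\<close> the geometric sum is invertible modulo \<open>\<pi>\<close> when \<open>n\<close> is prime to 7 or equal to 7.

  A parabolic element has a double eigenvalue \<open>x\<close> of modulus 1, so its trace \<open>t = 2 x + x\<^sup>-\<^sup>2\<close> has
  modulus at most 3. For \<open>A \<equiv> 1\<close> we have \<open>t \<equiv> 3\<close>, which leaves \<open>t = 3\<close>, where \<open>A\<close> is unipotent by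
  Cayley-Hamilton, and \<open>t = (- 1 \<plusminus> i \<surd>7) / 2\<close>, where the eigenvalues are distinct.\<close>

section \<open>The ring of integers\<close>

lemma isqrt7_sq: "isqrt7 * isqrt7 = -7"
  by (simp add: isqrt7_def complex_eq_iff)

lemma cnj_isqrt7: "cnj isqrt7 = - isqrt7"
  by (simp add: isqrt7_def)

text \<open>As -7 is congruent to 1 modulo 4, this number and 1 form an integral basis.\<close>

definition omega7 :: complex where
  "omega7 = (1 + isqrt7) / 2"

lemma omega7_sq: "omega7 * omega7 = omega7 - 2"
  using isqrt7_sq by (simp add: omega7_def field_simps)

lemma cnj_omega7: "cnj omega7 = 1 - omega7"
  by (simp add: omega7_def cnj_isqrt7 field_simps)

lemma isqrt7_eq_omega7: "isqrt7 = 2 * omega7 - 1"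
  by (simp add: omega7_def field_simps)

lemma Re_omega7: "Re omega7 = 1 / 2" and Im_omega7: "Im omega7 = sqrt 7 / 2"
  by (simp_all add: omega7_def isqrt7_def)

lemma algebraic_int_quadratic:
  fixes b c :: int and z :: "'a :: field_char_0"
  assumes "z * z + of_int b * z + of_int c = 0"
  shows "algebraic_int z"
proof -
  have "poly (map_poly of_int [:c, b, 1:]) z = 0"
    using assms by (simp add: map_poly_pCons algebra_simps)
  moreover have "lead_coeff [:c, b, 1:] = 1" by simp
  ultimately show ?thesis unfolding algebraic_int_altdef_ipoly by blast
qed

text \<open>Gauss's lemma: the primitive minimal polynomial of a non-real quadratic algebraic integer
  divides a monic integer polynomial, so it is monic itself.\<close>

lemma quadratic_algebraic_int_monic:
  fixes z :: complex and d e f :: int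
  assumes "algebraic_int z" "Im z \<noteq> 0" "d \<noteq> 0"
    and root: "of_int d * z * z + of_int e * z + of_int f = 0"
  obtains b c :: int where "z * z + of_int b * z + of_int c = 0"
proof -
  define q0 where "q0 = [:f, e, d:]"
  define q where "q = primitive_part q0"
  have q0: "q0 \<noteq> 0" "degree q0 = 2" using \<open>d \<noteq> 0\<close> by (auto simp: q0_def)
  have deg_q: "degree q = 2" and cont_q: "content q = 1" and "q \<noteq> 0"
    using q0 by (auto simp: q_def)
  have eval_smult: "poly (map_poly of_int (smult k r)) z = of_int k * poly (map_poly of_int r) z"
    for k and r :: "int poly"
    by (simp add: map_poly_smult)
  have eval_add: "poly (map_poly of_int (r + s)) z = poly (map_poly of_int r) z + poly (map_poly of_int s) z"
    for r s :: "int poly"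
  proof -
    have "map_poly of_int (r + s) = map_poly of_int r + (map_poly of_int s :: complex poly)"
      by (rule poly_eqI) (simp add: coeff_map_poly)
    then show ?thesis by simp
  qed
  have eval_mult: "poly (map_poly of_int (r * s)) z = poly (map_poly of_int r) z * poly (map_poly of_int s) z"
    for r s :: "int poly"
    by (induction r) (simp_all add: eval_add eval_smult map_poly_pCons algebra_simps)
  have "poly (map_poly of_int q0) z = 0"
    using root by (simp add: q0_def map_poly_pCons algebra_simps)
  moreover have "q0 = smult (content q0) q" by (simp add: q_def)
  ultimately have "of_int (content q0) * poly (map_poly of_int q) z = 0"
    by (metis eval_smult)
  then have qz: "poly (map_poly of_int q) z = 0" using q0 by simp
  obtain p where p: "poly (map_poly of_int p) z = 0" "lead_coeff p = (1::int)"
    using assms(1) unfolding algebraic_int_altdef_ipoly by blast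
  \<comment> \<open>Pseudo-division stays over the integers. Its remainder is at most linear and
    vanishes at the non-real \<open>z\<close>, hence is zero.\<close>
  obtain k h where k: "k \<noteq> 0" "smult k p = q * h + pseudo_mod p q"
    using pseudo_mod(1)[OF \<open>q \<noteq> 0\<close>, of p] by blast
  define r where "r = pseudo_mod p q"
  have "poly (map_poly of_int r) z = 0"
    using arg_cong[OF k(2), of "\<lambda>x. poly (map_poly of_int x) z"] p(1) qz
    by (simp add: eval_smult eval_add eval_mult r_def)
  moreover have "degree r < 2 \<or> r = 0"
    using pseudo_mod(2)[OF \<open>q \<noteq> 0\<close>, of p] deg_q by (auto simp: r_def)
  then have "degree r \<le> 1" by auto
  then have "r = [:coeff r 0, coeff r 1:]"
    by (intro poly_eqI) (auto simp: coeff_pCons coeff_eq_0 split: nat.splits)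
  then obtain r0 r1 where r01: "r = [:r0, r1:]" by blast
  ultimately have "of_int r0 + of_int r1 * z = 0"
    by (simp add: map_poly_pCons algebra_simps)
  then have "r1 = 0" "r0 = 0" using \<open>Im z \<noteq> 0\<close> by (auto simp: complex_eq_iff)
  then have kp: "smult k p = q * h" using k r01 by (simp add: r_def)
  \<comment> \<open>Both \<open>p\<close> and \<open>q\<close> are primitive, so \<open>h\<close>
    has content \<open>k\<close> up to sign. Cancelling \<open>k\<close> from the leading
    coefficients exhibits that of \<open>q\<close> as a unit with inverse \<open>m\<close>.\<close>
  have "content p = 1"
    using p(2) content_dvd_coeff[of p "degree p"] by (metis is_unit_content_iff)
  then have "normalize k = content h"
    using arg_cong[OF kp, of content] cont_q by (simp add: content_mult)
  then have "k dvd lead_coeff h"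
    by (metis content_dvd_coeff normalize_dvd_iff)
  then obtain m where m: "lead_coeff h = k * m" by blast
  have "k = lead_coeff q * lead_coeff h"
    using arg_cong[OF kp, of lead_coeff] p(2) k(1) by (simp add: lead_coeff_mult)
  then have "lead_coeff q * m = 1" using m k(1) by (simp add: mult.assoc mult.left_commute)
  then have lq: "coeff q 2 * m = 1" using deg_q by simp
  define b where "b = coeff q 1 * m"
  define c where "c = coeff q 0 * m"
  have "q = [:coeff q 0, coeff q 1, coeff q 2:]"
    using deg_q by (intro poly_eqI) (auto simp: coeff_pCons coeff_eq_0 numeral_2_eq_2 split: nat.splits)
  moreover have "poly (map_poly of_int [:u, v, w:]) z = of_int u + z * (of_int v + z * of_int w)"
    for u v w :: int
    by (simp add: map_poly_pCons)
  ultimately have "of_int (coeff q 0) + z * (of_int (coeff q 1) + z * of_int (coeff q 2)) = 0"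
    using qz by metis
  then have "of_int m * (of_int (coeff q 0) + z * (of_int (coeff q 1) + z * of_int (coeff q 2))) = 0"
    by simp
  moreover have "of_int (coeff q 2) * of_int m = (1::complex)"
    using lq by (metis of_int_1 of_int_mult)
  ultimately have "z * z + of_int b * z + of_int c = 0"
    unfolding b_def c_def of_int_mult by algebra
  then show ?thesis using that by blast
qed

lemma complex_of_rat_parts: "Re (of_rat q) = of_rat q" "Im (of_rat q) = 0"
proof -
  have "(of_rat q :: complex) = of_real (of_rat q)"
    by (cases q) (simp add: of_rat_rat)
  then show "Re (of_rat q) = of_rat q" "Im (of_rat q) = 0" by simp_all
qed

text \<open>From right to left, trace and norm of \<open>z\<close> are integers. From left to right,
  clearing denominators gives an integral quadratic equation, which Gauss's lemma makes monic; this
  leaves only 2 as a denominator of the coordinates.\<close>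

lemma O7_iff: "z \<in> O7 \<longleftrightarrow> (\<exists>m n::int. z = of_int m + of_int n * omega7)"
proof
  assume "\<exists>m n::int. z = of_int m + of_int n * omega7"
  then obtain m n :: int where z: "z = of_int m + of_int n * omega7" by blast
  have "z = of_rat (of_int m + of_int n / 2) + of_rat (of_int n / 2) * isqrt7"
    by (simp add: z omega7_def of_rat_add of_rat_divide of_rat_mult field_simps)
  then have "z \<in> Q_isqrt7" unfolding Q_isqrt7_def by blast
  moreover have "z * z + of_int (- 2 * m - n) * z + of_int (m * m + m * n + 2 * n * n) = 0"
    unfolding z of_int_add of_int_diff of_int_mult of_int_minus using omega7_sq by simp algebra
  ultimately show "z \<in> O7" unfolding O7_def using algebraic_int_quadratic by blast
next
  assume "z \<in> O7"
  then obtain r s where z: "z = of_rat r + of_rat s * isqrt7" and alg: "algebraic_int z"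
    unfolding O7_def Q_isqrt7_def by blast
  have Re_z: "Re z = of_rat r" and Im_z: "Im z = of_rat s * sqrt 7"
    by (simp_all add: z isqrt7_def complex_of_rat_parts)
  show "\<exists>m n::int. z = of_int m + of_int n * omega7"
  proof (cases "s = 0")
    case True
    then have "z \<in> \<rat>" by (simp add: z)
    then have "z \<in> \<int>" using rational_algebraic_int_is_int alg by blast
    then obtain m where "z = of_int m" by (auto elim: Ints_cases)
    then have "z = of_int m + of_int 0 * omega7" by simp
    then show ?thesis by blast
  next
    case False
    obtain r1 r2 where r: "r = of_int r1 / of_int r2" "r2 > 0"
      by (metis quotient_of_div quotient_of_denom_pos surj_pair)
    obtain s1 s2 where s: "s = of_int s1 / of_int s2" "s2 > 0"
      by (metis quotient_of_div quotient_of_denom_pos surj_pair)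
    have zq: "of_int r2 * of_int s2 * z = of_int (r1 * s2) + of_int (s1 * r2) * isqrt7"
    proof -
      have "of_rat r * of_int r2 = (of_int r1 :: complex)" "of_rat s * of_int s2 = (of_int s1 :: complex)"
        using r s by (simp_all add: of_rat_divide)
      from this[symmetric] show ?thesis unfolding z of_int_mult by (simp add: algebra_simps)
    qed
    have "of_int (r2 * r2 * s2 * s2) * z * z + of_int (- 2 * r1 * r2 * s2 * s2) * z
        + of_int (r1 * r1 * s2 * s2 + 7 * s1 * s1 * r2 * r2) = 0"
      using zq isqrt7_sq unfolding of_int_add of_int_mult of_int_minus by simp algebra
    moreover have "Im z \<noteq> 0" using False Im_z by simp
    moreover have "r2 * r2 * s2 * s2 \<noteq> 0" using r s by simp
    ultimately obtain b c :: int where bc: "z * z + of_int b * z + of_int c = 0"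
      using quadratic_algebraic_int_monic alg by metis
    have "Im (z * z + of_int b * z + of_int c) = 0" using bc by simp
    then have "(2 * Re z + of_int b) * Im z = 0" by (simp add: algebra_simps)
    then have Re2: "2 * Re z = - of_int b" using \<open>Im z \<noteq> 0\<close> by simp
    have "Re (z * z + of_int b * z + of_int c) = 0" using bc by simp
    then have "Re z * Re z - Im z * Im z + of_int b * Re z + of_int c = 0" by simp
    then have Im2: "4 * (Im z * Im z) = 4 * of_int c - of_int b * of_int b"
      using Re2 by algebra
    have "4 * (Im z * Im z) = 28 * (of_rat s * of_rat s)"
      unfolding Im_z using real_sqrt_mult_self[of 7] by simp
    then have sq: "28 * (of_rat s * of_rat s) = (of_int (4 * c - b * b) :: real)"
      using Im2 by simp
    \<comment> \<open>As 28 s^2 is an integer, 14 s is a rational algebraic integer. Its square is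
      divisible by 7, hence so is 14 s, and 2 s is an integer.\<close>
    then have "algebraic_int (of_rat (14 * s) :: real)"
      by (intro algebraic_int_quadratic[of _ 0 "- 7 * (4 * c - b * b)"]) (simp add: of_rat_mult)
    then have "(of_rat (14 * s) :: real) \<in> \<int>"
      by (intro rational_algebraic_int_is_int) auto
    then obtain e where e: "(of_rat (14 * s) :: real) = of_int e" by (auto elim: Ints_cases)
    then have e14: "14 * of_rat s = (of_int e :: real)" by (simp add: of_rat_mult)
    have "(of_int (e * e) :: real) = of_int (7 * (4 * c - b * b))"
      using sq unfolding of_int_mult e14[symmetric] by simp
    then have ee: "e * e = 7 * (4 * c - b * b)" by (simp only: of_int_eq_iff)
    then have "7 dvd e * e" by simp
    then have "7 dvd e" using prime_dvd_mult_iff[of "7::int" e e] by simp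
    then obtain n where n: "e = 7 * n" by blast
    have nb: "7 * (n * n) = 4 * c - b * b" using ee n by simp
    \<comment> \<open>Modulo 2 the relation 7 n^2 = 4 c - b^2 makes \<open>n\<close> and
      \<open>b\<close> congruent, so 2 Re z - n is even.\<close>
    have "even (n + b)"
    proof (rule ccontr)
      assume "odd (n + b)"
      moreover have "even (7 * (n * n) + b * b)" using nb by simp
      ultimately show False by auto
    qed
    then have "even (- b - n)" by presburger
    then obtain m where m: "- b - n = 2 * m" by blast
    have sn: "2 * of_rat s = (of_int n :: real)" using e14 n by simp
    have "Re z = of_int m + of_int n / 2" using Re2 m
      by (smt (verit) of_int_add of_int_diff of_int_minus field_sum_of_halves)
    moreover have "Im z = of_int n * (sqrt 7 / 2)" using sn Im_z by simp
    ultimately have "z = of_int m + of_int n * omega7"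
      by (simp add: complex_eq_iff Re_omega7 Im_omega7)
    then show ?thesis by blast
  qed
qed

section \<open>Arithmetic in the integral basis and the residue map\<close>

lemma O7_E:
  assumes "z \<in> O7"
  obtains m n :: int where "z = of_int m + of_int n * omega7"
  using assms O7_iff by blast

lemma O7_I: "of_int m + of_int n * omega7 \<in> O7"
  using O7_iff by blast

lemma O7_of_int: "of_int m \<in> O7"
  using O7_I[of m 0] by simp

lemma O7_0 [simp]: "0 \<in> O7" and O7_1 [simp]: "1 \<in> O7"
  using O7_of_int[of 0] O7_of_int[of 1] by simp_all

lemma omega7_in_O7: "omega7 \<in> O7"
  using O7_I[of 0 1] by simp

lemma isqrt7_in_O7: "isqrt7 \<in> O7"
  using O7_I[of "-1" 2] by (simp add: isqrt7_eq_omega7)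

lemma omega7_mult:
  "(of_int m + of_int n * omega7) * (of_int p + of_int q * omega7)
     = of_int (m * p - 2 * n * q) + of_int (m * q + n * p + n * q) * omega7"
  using omega7_sq unfolding of_int_add of_int_diff of_int_mult by simp algebra

lemma O7_add: "x \<in> O7 \<Longrightarrow> y \<in> O7 \<Longrightarrow> x + y \<in> O7"
proof -
  assume "x \<in> O7" "y \<in> O7"
  then obtain m n p q :: int
    where "x = of_int m + of_int n * omega7" "y = of_int p + of_int q * omega7"
    by (metis O7_E)
  then have "x + y = of_int (m + p) + of_int (n + q) * omega7" by (simp add: algebra_simps)
  then show ?thesis by (metis O7_I)
qed

lemma O7_mult: "x \<in> O7 \<Longrightarrow> y \<in> O7 \<Longrightarrow> x * y \<in> O7"
  by (metis O7_E O7_I omega7_mult)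

lemma O7_minus: "x \<in> O7 \<Longrightarrow> - x \<in> O7"
  using O7_mult[OF O7_of_int[of "-1"], of x] by simp

lemma O7_diff: "x \<in> O7 \<Longrightarrow> y \<in> O7 \<Longrightarrow> x - y \<in> O7"
  using O7_add[of x "- y"] O7_minus by simp

lemma O7_sum: "(\<And>i. i \<in> I \<Longrightarrow> f i \<in> O7) \<Longrightarrow> sum f I \<in> O7"
  by (induction I rule: infinite_finite_induct) (simp_all add: O7_add)

lemma isqrt7_omega7: "isqrt7 * omega7 = omega7 - 4"
proof -
  have "isqrt7 * omega7 = 2 * (omega7 * omega7) - omega7"
    by (simp add: isqrt7_eq_omega7 algebra_simps)
  then show ?thesis by (simp add: omega7_sq)
qed

lemma cnj_omega7_form:
  "cnj (of_int m + of_int n * omega7) = of_int (m + n) + of_int (- n) * omega7"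
  by (simp add: cnj_omega7 algebra_simps)

lemma O7_cnj: "x \<in> O7 \<Longrightarrow> cnj x \<in> O7"
  by (metis O7_E O7_I cnj_omega7_form)

lemmas O7_closed = O7_of_int omega7_in_O7 isqrt7_in_O7 O7_add O7_mult O7_minus O7_diff O7_cnj

lemma norm_omega7_form:
  "(cmod (of_int m + of_int n * omega7))\<^sup>2 = of_int (m * m + m * n + 2 * n * n)"
proof -
  have "(cmod (of_int m + of_int n * omega7))\<^sup>2 = (of_int m + of_int n / 2)\<^sup>2 + (of_int n * (sqrt 7 / 2))\<^sup>2"
    unfolding cmod_power2 by (simp add: Re_omega7 Im_omega7)
  also have "\<dots> = (of_int m + of_int n / 2)\<^sup>2 + of_int n * of_int n * (sqrt 7 * sqrt 7 / 4)"
    by (simp add: power2_eq_square)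
  finally show ?thesis by (simp add: power2_eq_square field_simps)
qed

text \<open>The residue of \<open>m + n \<omega>\<close> modulo \<open>i \<surd>7 = 2 \<omega> - 1\<close> is that of \<open>m + 4 n\<close>, because 4 inverts 2
  modulo 7; and \<open>2 Re (m + n \<omega>) = 2 m + n\<close>.\<close>

definition res7 :: "complex \<Rightarrow> int" where
  "res7 z = 4 * \<lfloor>2 * Re z\<rfloor> mod 7"

lemma res7_form: "res7 (of_int m + of_int n * omega7) = (m + 4 * n) mod 7"
proof -
  have "2 * Re (of_int m + of_int n * omega7) = of_int (2 * m + n)" by (simp add: Re_omega7)
  then have "res7 (of_int m + of_int n * omega7) = 4 * (2 * m + n) mod 7"
    unfolding res7_def by (simp only: floor_of_int)
  also have "4 * (2 * m + n) = (m + 4 * n) + 7 * m" by simp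
  also have "\<dots> mod 7 = (m + 4 * n) mod 7" by (rule mod_mult_self2)
  finally show ?thesis .
qed

lemma res7_of_int: "res7 (of_int m) = m mod 7"
  using res7_form[of m 0] by simp

lemma res7_0 [simp]: "res7 0 = 0" and res7_1 [simp]: "res7 1 = 1"
  using res7_of_int[of 0] res7_of_int[of 1] by simp_all

lemma res7_isqrt7: "res7 isqrt7 = 0"
  using res7_form[of "-1" 2] by (simp add: isqrt7_eq_omega7)

lemma res7_mod [simp]: "res7 z mod 7 = res7 z"
  by (simp add: res7_def)

lemma res7_bounds: "0 \<le> res7 z" "res7 z < 7"
  by (simp_all add: res7_def)

lemma res7_add: "x \<in> O7 \<Longrightarrow> y \<in> O7 \<Longrightarrow> res7 (x + y) = (res7 x + res7 y) mod 7"
proof -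
  assume "x \<in> O7" "y \<in> O7"
  then obtain m n p q :: int
    where xy: "x = of_int m + of_int n * omega7" "y = of_int p + of_int q * omega7"
    by (metis O7_E)
  then have "x + y = of_int (m + p) + of_int (n + q) * omega7" by (simp add: algebra_simps)
  then have "res7 (x + y) = ((m + p) + 4 * (n + q)) mod 7" by (simp only: res7_form)
  also have "(m + p) + 4 * (n + q) = (m + 4 * n) + (p + 4 * q)" by simp
  also have "\<dots> mod 7 = ((m + 4 * n) mod 7 + (p + 4 * q) mod 7) mod 7" by (simp only: mod_add_eq)
  finally show ?thesis unfolding xy res7_form .
qed

text \<open>The value 4 given to \<open>omega7\<close> is a root of x^2 - x + 2 modulo 7, since 16 -
  4 + 2 = 14.\<close>

lemma res7_mult: "x \<in> O7 \<Longrightarrow> y \<in> O7 \<Longrightarrow> res7 (x * y) = res7 x * res7 y mod 7"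
proof -
  assume "x \<in> O7" "y \<in> O7"
  then obtain m n p q :: int
    where xy: "x = of_int m + of_int n * omega7" "y = of_int p + of_int q * omega7"
    by (metis O7_E)
  have "res7 (x * y) = ((m * p - 2 * n * q) + 4 * (m * q + n * p + n * q)) mod 7"
    unfolding xy omega7_mult by (simp only: res7_form)
  also have "(m * p - 2 * n * q) + 4 * (m * q + n * p + n * q)
      = (m + 4 * n) * (p + 4 * q) + 7 * (- 2 * n * q)"
    by (simp add: algebra_simps)
  also have "\<dots> mod 7 = ((m + 4 * n) mod 7) * ((p + 4 * q) mod 7) mod 7"
    by (simp only: mod_mult_self2 mod_mult_eq)
  finally show ?thesis unfolding xy res7_form .
qed

lemma res7_minus: "x \<in> O7 \<Longrightarrow> res7 (- x) = (- res7 x) mod 7"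
proof -
  assume "x \<in> O7"
  then obtain m n :: int where x: "x = of_int m + of_int n * omega7" by (metis O7_E)
  have "- x = of_int (- m) + of_int (- n) * omega7" by (simp add: x)
  then have "res7 (- x) = (- m + 4 * (- n)) mod 7" by (simp only: res7_form)
  also have "- m + 4 * (- n) = - (m + 4 * n)" by simp
  also have "\<dots> mod 7 = (- ((m + 4 * n) mod 7)) mod 7" by (simp only: mod_minus_eq)
  finally show ?thesis unfolding x res7_form .
qed

lemma res7_diff: "x \<in> O7 \<Longrightarrow> y \<in> O7 \<Longrightarrow> res7 (x - y) = (res7 x - res7 y) mod 7"
proof -
  assume "x \<in> O7" "y \<in> O7"
  then have "res7 (x - y) = (res7 x + (- res7 y) mod 7) mod 7"
    using res7_add[of x "- y"] by (simp only: O7_minus res7_minus diff_conv_add_uminus)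
  then show ?thesis by (simp only: mod_add_right_eq) simp
qed

text \<open>Conjugation sends \<open>omega7\<close> to \<open>1 - omega7\<close>, and 1 - 4 is again
  4 modulo 7.\<close>

lemma res7_cnj: "x \<in> O7 \<Longrightarrow> res7 (cnj x) = res7 x"
proof -
  assume "x \<in> O7"
  then obtain m n :: int where x: "x = of_int m + of_int n * omega7" by (metis O7_E)
  have "res7 (cnj x) = ((m + n) + 4 * (- n)) mod 7"
    unfolding x cnj_omega7_form by (simp only: res7_form)
  also have "(m + n) + 4 * (- n) = (m + 4 * n) + 7 * (- n)" by simp
  also have "\<dots> mod 7 = (m + 4 * n) mod 7" by (rule mod_mult_self2)
  finally show ?thesis unfolding x res7_form .
qed

lemma res7_eq_0_iff: "z \<in> O7 \<Longrightarrow> res7 z = 0 \<longleftrightarrow> z \<in> ideal_isqrt7"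
proof
  assume "z \<in> ideal_isqrt7"
  then obtain y where "z = isqrt7 * y" "y \<in> O7" unfolding ideal_isqrt7_def by blast
  then show "res7 z = 0" by (simp add: res7_mult isqrt7_in_O7 res7_isqrt7)
next
  assume "z \<in> O7" "res7 z = 0"
  then obtain m n :: int where z: "z = of_int m + of_int n * omega7" by (metis O7_E)
  have "(m + 4 * n) mod 7 = 0" using \<open>res7 z = 0\<close> by (simp only: z res7_form)
  \<comment> \<open>With m = 7 k - 4 n, both 7 = - isqrt7^2 and omega7 - 4 = isqrt7 omega7 supply a
    factor \<open>isqrt7\<close>.\<close>
  then obtain k where "m + 4 * n = 7 * k" by auto
  then have "m = 7 * k - 4 * n" by simp
  have "z = - of_int k * (isqrt7 * isqrt7) + of_int n * (isqrt7 * omega7)"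
    unfolding z isqrt7_sq isqrt7_omega7 \<open>m = 7 * k - 4 * n\<close> by (simp add: algebra_simps)
  also have "\<dots> = isqrt7 * (of_int (- k) * isqrt7 + of_int n * omega7)"
    by (simp add: algebra_simps)
  finally have "z = isqrt7 * (of_int (- k) * isqrt7 + of_int n * omega7)" .
  moreover have "of_int (- k) * isqrt7 + of_int n * omega7 \<in> O7"
    by (intro O7_closed)
  ultimately show "z \<in> ideal_isqrt7" unfolding ideal_isqrt7_def by blast
qed

lemma res7_eq_iff:
  assumes "x \<in> O7" "y \<in> O7"
  shows "x - y \<in> ideal_isqrt7 \<longleftrightarrow> res7 x = res7 y"
proof -
  have "x - y \<in> ideal_isqrt7 \<longleftrightarrow> (res7 x - res7 y) mod 7 = 0"
    using assms res7_eq_0_iff[of "x - y"] by (simp add: O7_diff res7_diff)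
  also have "\<dots> \<longleftrightarrow> res7 x mod 7 = res7 y mod 7" by (simp only: mod_eq_dvd_iff dvd_eq_mod_eq_0)
  finally show ?thesis by simp
qed

section \<open>Reduction of matrices\<close>

text \<open>Residues are the integers 0 to 6 and not elements of a field type, so products of
  reduced matrices need another reduction modulo 7.\<close>

definition red7 :: "complex^3^3 \<Rightarrow> int^3^3" where
  "red7 A = (\<chi> i j. res7 (A $ i $ j))"

lemma mats_O7_nth: "A \<in> mats_O7 \<Longrightarrow> A $ i $ j \<in> O7"
  by (simp add: mats_O7_def)

lemma mat_nth: "mat a $ i $ j = (if i = j then a else 0)"
  by (simp add: mat_def)

lemma mats_O7_mat: "a \<in> O7 \<Longrightarrow> mat a \<in> mats_O7"
  by (simp add: mats_O7_def mat_nth)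

lemma mats_O7_mult: "A \<in> mats_O7 \<Longrightarrow> B \<in> mats_O7 \<Longrightarrow> A ** B \<in> mats_O7"
  by (simp add: mats_O7_def matrix_matrix_mult_def O7_sum O7_mult)

lemma mats_O7_minus: "A \<in> mats_O7 \<Longrightarrow> - A \<in> mats_O7"
  by (simp add: mats_O7_def O7_minus)

lemma mats_O7_add: "A \<in> mats_O7 \<Longrightarrow> B \<in> mats_O7 \<Longrightarrow> A + B \<in> mats_O7"
  by (simp add: mats_O7_def O7_add)

lemma red7_mult_nth:
  assumes "A \<in> mats_O7" "B \<in> mats_O7"
  shows "red7 (A ** B) $ i $ j = (red7 A ** red7 B) $ i $ j mod 7"
  using mats_O7_nth[OF assms(1)] mats_O7_nth[OF assms(2)]
  by (simp add: red7_def matrix_matrix_mult_def sum_3 res7_add res7_mult O7_add O7_mult mod_simps)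

lemma red7_mult_cong:
  assumes "A \<in> mats_O7" "B \<in> mats_O7" "C \<in> mats_O7" "D \<in> mats_O7" "red7 A = red7 C" "red7 B = red7 D"
  shows "red7 (A ** B) = red7 (C ** D)"
  unfolding vec_eq_iff using assms by (simp only: red7_mult_nth) simp

lemma cong_id_iff: "A \<in> mats_O7 \<Longrightarrow> cong_id A \<longleftrightarrow> red7 A = red7 (mat 1)"
  unfolding cong_id_def
  by (simp add: vec_eq_iff res7_eq_iff mats_O7_nth mats_O7_mat red7_def)

lemma det_in_O7: "A \<in> mats_O7 \<Longrightarrow> det A \<in> O7"
  unfolding det_3 by (intro O7_closed mats_O7_nth)

lemma res7_det: "A \<in> mats_O7 \<Longrightarrow> res7 (det A) = det (red7 A) mod 7"
  unfolding det_3 red7_def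
  by (simp only: mats_O7_nth O7_add O7_diff O7_mult res7_add res7_diff res7_mult vec_lambda_beta mod_simps)

section \<open>The unitary group of the form\<close>

lemma Jmat_nth [simp]:
  "Jmat $ 1 $ 1 = 0" "Jmat $ 1 $ 2 = 0" "Jmat $ 1 $ 3 = 1"
  "Jmat $ 2 $ 1 = 0" "Jmat $ 2 $ 2 = 1" "Jmat $ 2 $ 3 = 0"
  "Jmat $ 3 $ 1 = 1" "Jmat $ 3 $ 2 = 0" "Jmat $ 3 $ 3 = 0"
  by (simp_all add: Jmat_def)

lemma herm_eq: "herm v w = v $ 3 * cnj (w $ 1) + v $ 2 * cnj (w $ 2) + v $ 1 * cnj (w $ 3)"
  by (simp add: herm_def sum_3 matrix_vector_mult_def)

lemma herm_diff_left: "herm (u - v) w = herm u w - herm v w"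
  and herm_scale_left: "herm (c *s v) w = c * herm v w"
  and herm_scale_right: "herm v (c *s w) = cnj c * herm v w"
  by (simp_all add: herm_eq algebra_simps)

lemma herm_nondegenerate: "(\<And>u. herm u v = herm u w) \<Longrightarrow> v = w"
proof -
  assume h: "\<And>u. herm u v = herm u w"
  have "herm (axis i 1) v = cnj (v $ (if i = 3 then 1 else if i = 2 then 2 else 3))" for i v
    using exhaust_3[of i] by (auto simp: herm_eq axis_def)
  then have "v $ (if i = 3 then 1 else if i = 2 then 2 else 3) =
      w $ (if i = 3 then 1 else if i = 2 then 2 else 3)" for i :: 3
    using h[of "axis i 1"] by simp
  from this[of 1] this[of 2] this[of 3] show "v = w"
    by (simp add: vec_eq_iff forall_3)
qed

text \<open>The adjoint \<open>J A\<^sup>* J\<close> with respect to the form.\<close>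

definition adjJ :: "complex^3^3 \<Rightarrow> complex^3^3" where
  "adjJ A = vector [vector [cnj (A $ 3 $ 3), cnj (A $ 2 $ 3), cnj (A $ 1 $ 3)],
                    vector [cnj (A $ 3 $ 2), cnj (A $ 2 $ 2), cnj (A $ 1 $ 2)],
                    vector [cnj (A $ 3 $ 1), cnj (A $ 2 $ 1), cnj (A $ 1 $ 1)]]"

lemma herm_adjJ: "herm (A *v v) w = herm v (adjJ A *v w)"
  by (simp add: herm_eq matrix_vector_mult_def sum_3 adjJ_def algebra_simps)

lemma UJ_iff_left: "A \<in> UJ \<longleftrightarrow> adjJ A ** A = mat 1"
proof
  assume "A \<in> UJ"
  then have "herm v (adjJ A *v (A *v w)) = herm v w" for v w
    unfolding UJ_def by (simp add: herm_adjJ[symmetric])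
  then have "adjJ A *v (A *v w) = w" for w
    by (rule herm_nondegenerate)
  then have "(adjJ A ** A) *v w = mat 1 *v w" for w
    by (simp add: matrix_vector_mul_assoc)
  then show "adjJ A ** A = mat 1" using matrix_eq by blast
next
  assume "adjJ A ** A = mat 1"
  then show "A \<in> UJ"
    unfolding UJ_def by (simp add: herm_adjJ matrix_vector_mul_assoc)
qed

lemma UJ_iff_right: "A \<in> UJ \<longleftrightarrow> A ** adjJ A = mat 1"
  using UJ_iff_left matrix_left_right_inverse by blast

lemma UJ_herm: "A \<in> UJ \<Longrightarrow> herm (A *v v) (A *v w) = herm v w"
  by (simp add: UJ_def)

lemma adjJ_adjJ [simp]: "adjJ (adjJ A) = A"
  by (simp add: adjJ_def vec_eq_iff forall_3)

lemma adjJ_in_UJ: "A \<in> UJ \<Longrightarrow> adjJ A \<in> UJ"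
  using UJ_iff_left[of "adjJ A"] UJ_iff_right[of A] by simp

lemma adjJ_mats_O7: "A \<in> mats_O7 \<Longrightarrow> adjJ A \<in> mats_O7"
  by (simp add: mats_O7_def forall_3 adjJ_def O7_cnj)

lemma UJ_mult: "A \<in> UJ \<Longrightarrow> B \<in> UJ \<Longrightarrow> A ** B \<in> UJ"
  by (simp add: UJ_def matrix_vector_mul_assoc[symmetric])

lemma UJ_mat_1: "mat 1 \<in> UJ"
  by (simp add: UJ_def)

lemma minus_matrix_mult: "(- A) ** B = - (A ** B)" "A ** (- B) = - (A ** B)"
  for A B :: "'a::comm_ring_1^3^3"
  by (simp_all add: vec_eq_iff matrix_matrix_mult_def sum_negf)

lemma minus_matrix_vector_mult: "(- A) *v v = - (A *v v)" for A :: "'a::comm_ring_1^3^3"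
  by (simp add: vec_eq_iff matrix_vector_mult_def sum_negf)

lemma UJ_minus: "A \<in> UJ \<Longrightarrow> - A \<in> UJ"
  by (simp add: UJ_def minus_matrix_vector_mult) (simp add: herm_eq)

lemma det_minus3: "det (- A) = - det A" for A :: "'a::comm_ring_1^3^3"
  by (simp add: det_3)

lemma det_adjJ: "det (adjJ A) = cnj (det A)"
  by (simp add: det_3 adjJ_def algebra_simps)

lemma UJ_norm_det: "A \<in> UJ \<Longrightarrow> det A * cnj (det A) = 1"
  using UJ_iff_right[of A] det_mul[of A "adjJ A"] by (simp add: det_adjJ)

section \<open>The integral unitary group and its quotient by the sign\<close>

abbreviation UO7 :: "(complex^3^3) set" where
  "UO7 \<equiv> carrier UJ_O7"

text \<open>The inverse of a unitary matrix is its adjoint, whose entries are conjugates and so stay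
  in \<open>O7\<close>; invertibility over \<open>O7\<close> is automatic.\<close>

lemma UO7_iff: "A \<in> UO7 \<longleftrightarrow> A \<in> UJ \<and> A \<in> mats_O7"
  unfolding UJ_O7_def GL3_O7_def
  using UJ_iff_left UJ_iff_right adjJ_mats_O7 by auto

lemma mult_UJ_O7 [simp]: "A \<otimes>\<^bsub>UJ_O7\<^esub> B = A ** B"
  and one_UJ_O7 [simp]: "\<one>\<^bsub>UJ_O7\<^esub> = mat 1"
  by (simp_all add: UJ_O7_def)

lemma UO7_mult: "A \<in> UO7 \<Longrightarrow> B \<in> UO7 \<Longrightarrow> A ** B \<in> UO7"
  and UO7_mat_1: "mat 1 \<in> UO7"
  and UO7_minus: "A \<in> UO7 \<Longrightarrow> - A \<in> UO7"
  and UO7_adjJ: "A \<in> UO7 \<Longrightarrow> adjJ A \<in> UO7"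
  by (simp_all add: UO7_iff UJ_mult UJ_mat_1 UJ_minus adjJ_in_UJ mats_O7_mult mats_O7_mat
      mats_O7_minus adjJ_mats_O7)

lemma adjJ_inverse: "A \<in> UO7 \<Longrightarrow> adjJ A ** A = mat 1" "A \<in> UO7 \<Longrightarrow> A ** adjJ A = mat 1"
  using UO7_iff UJ_iff_left UJ_iff_right by blast+

lemma group_UJ_O7: "group UJ_O7"
proof (rule groupI)
  fix A assume "A \<in> UO7"
  then show "\<exists>B\<in>UO7. B \<otimes>\<^bsub>UJ_O7\<^esub> A = \<one>\<^bsub>UJ_O7\<^esub>"
    using UO7_adjJ adjJ_inverse by (intro bexI[of _ "adjJ A"]) auto
qed (auto simp: UO7_mult UO7_mat_1 matrix_mul_assoc)

interpretation U: group UJ_O7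
  by (rule group_UJ_O7)

lemma normal_center: "{mat 1, - mat 1} \<lhd> UJ_O7"
  unfolding U.normal_inv_iff
proof
  have inv: "inv\<^bsub>UJ_O7\<^esub> (- mat 1) = - mat 1"
    by (rule U.inv_equality) (auto simp: minus_matrix_mult UO7_minus UO7_mat_1)
  show "subgroup {mat 1, - mat 1} UJ_O7"
    by (rule U.subgroupI) (auto simp: inv U.inv_one[simplified] UO7_minus UO7_mat_1 minus_matrix_mult)
  show "\<forall>x\<in>UO7. \<forall>h\<in>{mat 1, - mat 1}. x \<otimes>\<^bsub>UJ_O7\<^esub> h \<otimes>\<^bsub>UJ_O7\<^esub> inv\<^bsub>UJ_O7\<^esub> x \<in> {mat 1, - mat 1}"
  proof (intro ballI)
    fix x h :: "complex^3^3" assume x: "x \<in> UO7" and h: "h \<in> {mat 1, - mat 1}"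
    have "x ** inv\<^bsub>UJ_O7\<^esub> x = mat 1" using U.r_inv[OF x] by simp
    then show "x \<otimes>\<^bsub>UJ_O7\<^esub> h \<otimes>\<^bsub>UJ_O7\<^esub> inv\<^bsub>UJ_O7\<^esub> x \<in> {mat 1, - mat 1}"
      using h by (auto simp: minus_matrix_mult)
  qed
qed

interpretation N: normal "{mat 1, - mat 1}" UJ_O7
  by (rule normal_center)

definition cls :: "complex^3^3 \<Rightarrow> (complex^3^3) set" where
  "cls A = {A, - A}"

lemma cls_coset: "cls A = {mat 1, - mat 1} #>\<^bsub>UJ_O7\<^esub> A"
  unfolding cls_def r_coset_def by (auto simp: minus_matrix_mult)

lemma carrier_PUJ_O7: "carrier PUJ_O7 = cls ` UO7"
  unfolding PUJ_O7_def FactGroup_def RCOSETS_def by (auto simp: cls_coset)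

lemma group_PUJ_O7: "group PUJ_O7"
  unfolding PUJ_O7_def by (rule N.factorgroup_is_group)

lemma cls_hom: "cls \<in> hom UJ_O7 PUJ_O7"
  using N.r_coset_hom_Mod unfolding PUJ_O7_def cls_coset[abs_def] by simp

lemma one_PUJ_O7: "\<one>\<^bsub>PUJ_O7\<^esub> = cls (mat 1)"
  by (simp add: PUJ_O7_def cls_def)

interpretation P: group PUJ_O7
  by (rule group_PUJ_O7)

interpretation cls: group_hom UJ_O7 PUJ_O7 cls
  by unfold_locales (rule cls_hom)

lemma cls_mult: "A \<in> UO7 \<Longrightarrow> B \<in> UO7 \<Longrightarrow> cls A \<otimes>\<^bsub>PUJ_O7\<^esub> cls B = cls (A ** B)"
  using cls.hom_mult[of A B] by simp

lemma cls_inv: "A \<in> UO7 \<Longrightarrow> inv\<^bsub>PUJ_O7\<^esub> (cls A) = cls (adjJ A)"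
proof -
  assume A: "A \<in> UO7"
  have "inv\<^bsub>UJ_O7\<^esub> A = adjJ A"
    using A by (intro U.inv_equality) (auto simp: adjJ_inverse UO7_adjJ)
  then show ?thesis using cls.hom_inv[OF A] by simp
qed

text \<open>The determinant is an element of \<open>O7\<close> of norm 1. Four times the norm is (2
  m + n)^2 + 7 n^2, which forces n = 0.\<close>

lemma det_UO7: "A \<in> UO7 \<Longrightarrow> det A = 1 \<or> det A = - 1"
proof -
  assume A: "A \<in> UO7"
  then obtain m n :: int where d: "det A = of_int m + of_int n * omega7"
    using det_in_O7 O7_E UO7_iff by metis
  have "complex_of_real ((cmod (det A))\<^sup>2) = 1"
    using UJ_norm_det[of A] A by (simp only: complex_norm_square UO7_iff)
  then have "(cmod (det A))\<^sup>2 = 1" by (simp only: of_real_eq_1_iff)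
  then have "(of_int (m * m + m * n + 2 * n * n) :: real) = 1"
    by (simp only: d norm_omega7_form)
  then have eq: "m * m + m * n + 2 * n * n = 1"
    by (simp only: of_int_eq_1_iff)
  then have "(2 * m + n) * (2 * m + n) + 7 * (n * n) = 4" by (simp add: algebra_simps)
  then have "7 * (n * n) \<le> 4" using zero_le_square[of "2 * m + n"] by linarith
  then have "n * n \<le> 0" by linarith
  then have "n = 0" using zero_le_square[of n] by (metis antisym mult_eq_0_iff)
  then have "m = 1 \<or> m = -1" using eq by (simp add: zmult_eq_1_iff)
  then show ?thesis using d \<open>n = 0\<close> by auto
qed

section \<open>The subgroup\<close>

text \<open>This settles the sign: a class in \<open>Gamma0\<close> is represented by that one of
  its matrices which is congruent to the identity.\<close>

lemma Gamma0_eq: "Gamma0 = cls ` {A \<in> UO7. red7 A = red7 (mat 1)}"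
proof (intro Set.set_eqI iffI)
  fix g assume "g \<in> Gamma0"
  then obtain B A where "B \<in> UO7" "g = cls B" "A \<in> g" "cong_id A"
    unfolding Gamma0_def carrier_PUJ_O7 by blast
  then have A: "A = B \<or> A = - B" by (simp add: cls_def)
  then have "A \<in> UO7" using \<open>B \<in> UO7\<close> UO7_minus by blast
  moreover have "g = cls A" using A \<open>g = cls B\<close> by (auto simp: cls_def)
  moreover have "red7 A = red7 (mat 1)"
    using \<open>A \<in> UO7\<close> \<open>cong_id A\<close> cong_id_iff UO7_iff by blast
  ultimately show "g \<in> cls ` {A \<in> UO7. red7 A = red7 (mat 1)}" by blast
next
  fix g assume "g \<in> cls ` {A \<in> UO7. red7 A = red7 (mat 1)}"
  then obtain A where "A \<in> UO7" "g = cls A" "red7 A = red7 (mat 1)" by blast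
  then show "g \<in> Gamma0"
    unfolding Gamma0_def carrier_PUJ_O7
    using cong_id_iff[of A] UO7_iff[of A] unfolding cls_def by blast
qed

lemma red7_UO7_mult_cong:
  assumes "A \<in> UO7" "B \<in> UO7" "C \<in> UO7" "D \<in> UO7" "red7 A = red7 C" "red7 B = red7 D"
  shows "red7 (A ** B) = red7 (C ** D)"
  using assms red7_mult_cong unfolding UO7_iff by blast

lemma red7_mult_adjJ_iff:
  assumes "A \<in> UO7" "B \<in> UO7"
  shows "red7 (A ** adjJ B) = red7 (mat 1) \<longleftrightarrow> red7 A = red7 B"
proof
  assume "red7 (A ** adjJ B) = red7 (mat 1)"
  then have "red7 ((A ** adjJ B) ** B) = red7 (mat 1 ** B)"
    using assms by (intro red7_UO7_mult_cong) (auto intro: UO7_mult UO7_adjJ UO7_mat_1)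
  then show "red7 A = red7 B"
    by (simp add: matrix_mul_assoc[symmetric] adjJ_inverse assms)
next
  assume "red7 A = red7 B"
  then have "red7 (A ** adjJ B) = red7 (B ** adjJ B)"
    using assms by (intro red7_UO7_mult_cong) (auto intro: UO7_adjJ)
  then show "red7 (A ** adjJ B) = red7 (mat 1)" by (simp add: adjJ_inverse assms)
qed

lemma subgroup_Gamma0: "subgroup Gamma0 PUJ_O7"
proof (rule P.subgroupI)
  show "Gamma0 \<subseteq> carrier PUJ_O7" unfolding Gamma0_def by blast
  show "Gamma0 \<noteq> {}" unfolding Gamma0_eq using UO7_mat_1 by blast
next
  fix g assume "g \<in> Gamma0"
  then obtain A where A: "A \<in> UO7" "g = cls A" "red7 A = red7 (mat 1)"
    unfolding Gamma0_eq by blast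
  have "red7 (mat 1 ** adjJ A) = red7 (mat 1)"
    using red7_mult_adjJ_iff[OF UO7_mat_1 A(1)] A(3) by simp
  then show "inv\<^bsub>PUJ_O7\<^esub> g \<in> Gamma0"
    unfolding Gamma0_eq using A UO7_adjJ by (simp add: cls_inv)
next
  fix g h assume "g \<in> Gamma0" "h \<in> Gamma0"
  then obtain A B where A: "A \<in> UO7" "g = cls A" "red7 A = red7 (mat 1)"
    and B: "B \<in> UO7" "h = cls B" "red7 B = red7 (mat 1)"
    unfolding Gamma0_eq by blast
  have "red7 (A ** B) = red7 (mat 1 ** mat 1)"
    using A B by (intro red7_UO7_mult_cong) (auto intro: UO7_mat_1)
  then show "g \<otimes>\<^bsub>PUJ_O7\<^esub> h \<in> Gamma0"
    unfolding Gamma0_eq using A B UO7_mult by (simp add: cls_mult)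
qed

text \<open>The possible determinants 1 and -1 have the distinct residues 1 and 6. Comparison with
  \<open>mat 1\<close> gives determinant 1, which later excludes the wrong sign.\<close>

lemma UO7_red7_det:
  assumes "A \<in> UO7" "B \<in> UO7" "red7 A = red7 B" shows "det A = det B"
proof -
  have m1: "res7 (- 1) = 6" using res7_of_int[of "-1"] by simp
  have "res7 (det A) = res7 (det B)"
    using assms res7_det[of A] res7_det[of B] unfolding UO7_iff by presburger
  with det_UO7[OF assms(1)] det_UO7[OF assms(2)] show ?thesis
    by (elim disjE) (simp_all add: m1)
qed

section \<open>Torsion\<close>

definition msc :: "'a \<Rightarrow> 'a::comm_ring_1^3^3 \<Rightarrow> 'a^3^3" where
  "msc c A = (\<chi> i j. c * A $ i $ j)"

lemma msc_nth [simp]: "msc c A $ i $ j = c * A $ i $ j"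
  by (simp add: msc_def)

lemma matrix_add_rdistrib: "(A + B) ** C = A ** C + B ** C"
  for A B C :: "'a::comm_ring_1^3^3"
  by (simp add: vec_eq_iff matrix_matrix_mult_def algebra_simps sum.distrib)

lemma matrix_diff_ldistrib: "A ** (B - C) = A ** B - A ** C"
  for A B C :: "'a::comm_ring_1^3^3"
  by (simp add: vec_eq_iff matrix_matrix_mult_def algebra_simps sum_subtractf)

lemma msc_mult_left: "msc c A ** B = msc c (A ** B)"
  and msc_mult_right: "A ** msc c B = msc c (A ** B)"
  by (simp_all add: vec_eq_iff matrix_matrix_mult_def sum_distrib_left mult_ac)

lemma msc_msc: "msc c (msc d A) = msc (c * d) A"
  and msc_add_right: "msc c (A + B) = msc c A + msc c B"
  and msc_0 [simp]: "msc 0 A = 0" "msc c 0 = 0"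
  and msc_1 [simp]: "msc 1 A = A"
  by (simp_all add: vec_eq_iff algebra_simps)

lemma mats_O7_msc: "c \<in> O7 \<Longrightarrow> A \<in> mats_O7 \<Longrightarrow> msc c A \<in> mats_O7"
  by (simp add: mats_O7_def O7_mult)

lemma ex_kernel_iff_det: "(\<exists>v. v \<noteq> 0 \<and> A *v v = 0) \<longleftrightarrow> det A = 0"
  for A :: "complex^3^3"
  using matrix_left_invertible_ker[of A] invertible_det_nz[of A]
    invertible_left_inverse[of A] by blast

lemma mult_eq_0_det_nz:
  fixes S X :: "complex^3^3"
  assumes "S ** X = 0" "det S \<noteq> 0" shows "X = 0"
proof -
  obtain T where "T ** S = mat 1"
    using assms(2) invertible_det_nz[of S] invertible_left_inverse[of S] by blast
  then have "X = T ** (S ** X)" by (simp add: matrix_mul_assoc)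
  then show ?thesis using assms(1) by simp
qed

text \<open>The matrix is scalar modulo \<open>isqrt7\<close>, so its determinant has residue c^3,
  which is nonzero because 7 is prime.\<close>

lemma det_unit_mod7:
  assumes "c \<in> O7" "res7 c \<noteq> 0" "W \<in> mats_O7"
  shows "det (mat c + msc isqrt7 W) \<noteq> 0"
proof
  define T where "T = mat c + msc isqrt7 W"
  assume "det (mat c + msc isqrt7 W) = 0"
  then have "res7 (det T) = 0" by (simp add: T_def)
  have "T \<in> mats_O7"
    unfolding T_def using assms by (intro mats_O7_add mats_O7_mat mats_O7_msc isqrt7_in_O7)
  have "red7 T = mat (res7 c)"
  proof -
    have "res7 (isqrt7 * W $ i $ j) = 0" for i j
      using mats_O7_nth[OF assms(3)] by (simp add: res7_mult isqrt7_in_O7 res7_isqrt7)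
    then show ?thesis
      using assms mats_O7_nth[OF assms(3)]
      by (simp add: vec_eq_iff red7_def T_def mat_nth res7_add O7_mult isqrt7_in_O7)
  qed
  then have "det (red7 T) = res7 c * res7 c * res7 c"
    by (simp add: det_3 mat_nth)
  then have "res7 c * res7 c * res7 c mod 7 = 0"
    using res7_det[OF \<open>T \<in> mats_O7\<close>] \<open>res7 (det T) = 0\<close> by simp
  then have "7 dvd res7 c * res7 c * res7 c" by (simp add: dvd_eq_mod_eq_0)
  then have "7 dvd res7 c" by (simp add: prime_dvd_mult_iff)
  then show False using assms(2) by (metis dvd_imp_mod_0 res7_mod)
qed

lemma cong_id_decompose:
  assumes "A \<in> UO7" "red7 A = red7 (mat 1)"
  obtains Y where "Y \<in> mats_O7" "A = mat 1 + msc isqrt7 Y"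
proof -
  have "cong_id A" using assms cong_id_iff UO7_iff by blast
  then have "\<forall>i j. \<exists>y. (A - mat 1) $ i $ j = isqrt7 * y \<and> y \<in> O7"
    unfolding cong_id_def ideal_isqrt7_def by blast
  then obtain y where y: "\<And>i j. (A - mat 1) $ i $ j = isqrt7 * y i j \<and> y i j \<in> O7"
    by metis
  have "A = mat 1 + msc isqrt7 (\<chi> i j. y i j)"
    using y by (simp add: vec_eq_iff algebra_simps)
  moreover have "(\<chi> i j. y i j) \<in> mats_O7"
    using y by (simp add: mats_O7_def)
  ultimately show ?thesis using that by blast
qed

section \<open>Powers and geometric sums of a matrix congruent to the identity\<close>

abbreviation upow :: "complex^3^3 \<Rightarrow> nat \<Rightarrow> complex^3^3" where
  "upow A n \<equiv> A [^]\<^bsub>UJ_O7\<^esub> n"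

lemma upow_Suc: "upow A (Suc n) = upow A n ** A"
  by simp

lemma geometric_sum_matrix:
  "(\<Sum>i<n. upow A i) ** (A - mat 1) = upow A n - mat 1"
proof (induction n)
  case (Suc n)
  then show ?case
    by (simp add: matrix_add_rdistrib matrix_diff_ldistrib) (simp add: algebra_simps)
qed simp

text \<open>Binomial expansion in powers of \<open>isqrt7\<close>, with everything from the third
  order on absorbed in \<open>Z\<close>.\<close>

lemma upow_expansion:
  assumes "Y \<in> mats_O7" "A = mat 1 + msc isqrt7 Y"
  shows "\<exists>Z\<in>mats_O7. upow A n = mat 1 + msc (of_nat n * isqrt7) Y
    + msc (of_nat (n choose 2) * (isqrt7 * isqrt7)) (Y ** Y) + msc (isqrt7 * isqrt7 * isqrt7) Z"
proof (induction n)
  case 0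
  show ?case
    by (rule bexI[of _ 0]) (simp_all add: mats_O7_def binomial_eq_0)
next
  case (Suc n)
  then obtain Z where Z: "Z \<in> mats_O7" "upow A n = mat 1 + msc (of_nat n * isqrt7) Y
    + msc (of_nat (n choose 2) * (isqrt7 * isqrt7)) (Y ** Y) + msc (isqrt7 * isqrt7 * isqrt7) Z"
    by blast
  \<comment> \<open>Multiplication by the summand \<open>msc isqrt7 Y\<close> raises the
    second-order term to third order and the old remainder to fourth.\<close>
  define Z' where "Z' = Z + msc (of_nat (n choose 2)) (Y ** Y ** Y) + msc isqrt7 (Z ** Y)"
  have choose: "Suc n choose 2 = n + (n choose 2)" by (simp add: numeral_2_eq_2)
  have "of_nat (n choose 2) \<in> O7" using O7_of_int[of "int (n choose 2)"] by simp
  then have "Z' \<in> mats_O7"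
    unfolding Z'_def using assms Z
    by (intro mats_O7_add mats_O7_msc mats_O7_mult isqrt7_in_O7)
  moreover have "upow A n ** (mat 1 + msc isqrt7 Y) = mat 1 + msc (of_nat (Suc n) * isqrt7) Y
    + msc (of_nat (Suc n choose 2) * (isqrt7 * isqrt7)) (Y ** Y) + msc (isqrt7 * isqrt7 * isqrt7) Z'"
    unfolding Z(2) choose Z'_def of_nat_add of_nat_Suc
    by (simp add: matrix_add_ldistrib matrix_add_rdistrib msc_mult_left msc_mult_right msc_msc
        msc_add_right)
      (simp add: vec_eq_iff algebra_simps)
  ultimately show ?case unfolding upow_Suc assms(2)[symmetric] by blast
qed

text \<open>Summation of the previous expansion: adding up i choose k over i < n gives n choose k +
  1.\<close>

lemma geometric_sum_expansion:
  assumes "Y \<in> mats_O7" "A = mat 1 + msc isqrt7 Y"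
  shows "\<exists>Z\<in>mats_O7. (\<Sum>i<n. upow A i) = mat (of_nat n) + msc (of_nat (n choose 2) * isqrt7) Y
    + msc (of_nat (n choose 3) * (isqrt7 * isqrt7)) (Y ** Y) + msc (isqrt7 * isqrt7 * isqrt7) Z"
proof (induction n)
  case 0
  show ?case
    by (rule bexI[of _ 0]) (simp_all add: mats_O7_def vec_eq_iff mat_nth binomial_eq_0)
next
  case (Suc n)
  then obtain Z where Z: "Z \<in> mats_O7" "(\<Sum>i<n. upow A i) = mat (of_nat n)
    + msc (of_nat (n choose 2) * isqrt7) Y
    + msc (of_nat (n choose 3) * (isqrt7 * isqrt7)) (Y ** Y) + msc (isqrt7 * isqrt7 * isqrt7) Z"
    by blast
  obtain Z1 where Z1: "Z1 \<in> mats_O7" "upow A n = mat 1 + msc (of_nat n * isqrt7) Y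
    + msc (of_nat (n choose 2) * (isqrt7 * isqrt7)) (Y ** Y) + msc (isqrt7 * isqrt7 * isqrt7) Z1"
    using upow_expansion[OF assms] by blast
  have choose: "Suc n choose 2 = n + (n choose 2)" "Suc n choose 3 = (n choose 2) + (n choose 3)"
    by (simp_all add: numeral_2_eq_2 numeral_3_eq_3)
  have "(\<Sum>i<Suc n. upow A i) = mat (of_nat (Suc n))
    + msc (of_nat (Suc n choose 2) * isqrt7) Y
    + msc (of_nat (Suc n choose 3) * (isqrt7 * isqrt7)) (Y ** Y)
    + msc (isqrt7 * isqrt7 * isqrt7) (Z + Z1)"
    unfolding sum.lessThan_Suc Z(2) Z1(2) choose of_nat_add of_nat_Suc
    by (simp add: vec_eq_iff mat_nth algebra_simps)
  then show ?case using mats_O7_add[OF Z(1) Z1(1)] by blast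
qed

lemma torsion_coprime:
  assumes "A \<in> UO7" "red7 A = red7 (mat 1)" "upow A n = mat 1" "\<not> 7 dvd n"
  shows "A = mat 1"
proof -
  obtain Y where Y: "Y \<in> mats_O7" "A = mat 1 + msc isqrt7 Y"
    using cong_id_decompose assms by blast
  obtain Z where Z: "Z \<in> mats_O7" "(\<Sum>i<n. upow A i) = mat (of_nat n)
    + msc (of_nat (n choose 2) * isqrt7) Y
    + msc (of_nat (n choose 3) * (isqrt7 * isqrt7)) (Y ** Y) + msc (isqrt7 * isqrt7 * isqrt7) Z"
    using geometric_sum_expansion[OF Y] by blast
  define W where "W = msc (of_nat (n choose 2)) Y + msc (of_nat (n choose 3) * isqrt7) (Y ** Y)
    + msc (isqrt7 * isqrt7) Z"
  have nat_O7: "of_nat k \<in> O7" for k using O7_of_int[of "int k"] by simp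
  have "W \<in> mats_O7"
    unfolding W_def using Y Z
    by (intro mats_O7_add mats_O7_msc mats_O7_mult O7_mult isqrt7_in_O7 nat_O7)
  have S: "(\<Sum>i<n. upow A i) = mat (of_nat n) + msc isqrt7 W"
    unfolding Z(2) W_def by (simp add: msc_add_right msc_msc mult_ac)
  have "\<not> 7 dvd int n" using assms(4) by presburger
  then have "res7 (of_nat n) \<noteq> 0" using res7_of_int[of "int n"] by (simp add: dvd_eq_mod_eq_0)
  then have "det (\<Sum>i<n. upow A i) \<noteq> 0"
    unfolding S using det_unit_mod7 nat_O7 \<open>W \<in> mats_O7\<close> by blast
  then have "A - mat 1 = 0"
    using mult_eq_0_det_nz geometric_sum_matrix[of A n] assms(3) by (metis diff_self)
  then show ?thesis by simp
qed

text \<open>Since \<open>7 = - \<pi>\<^sup>2\<close> and 7 divides the binomial coefficients 21 and 35, the geometric sum is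
  \<open>\<pi>\<^sup>2\<close> times a matrix that is congruent to \<open>- 1\<close>.\<close>

lemma torsion_7:
  assumes "A \<in> UO7" "red7 A = red7 (mat 1)" "upow A 7 = mat 1"
  shows "A = mat 1"
proof -
  obtain Y where Y: "Y \<in> mats_O7" "A = mat 1 + msc isqrt7 Y"
    using cong_id_decompose assms by blast
  obtain Z where Z: "Z \<in> mats_O7" "(\<Sum>i<7. upow A i) = mat (of_nat 7)
    + msc (of_nat (7 choose 2) * isqrt7) Y
    + msc (of_nat (7 choose 3) * (isqrt7 * isqrt7)) (Y ** Y) + msc (isqrt7 * isqrt7 * isqrt7) Z"
    using geometric_sum_expansion[OF Y] by blast
  \<comment> \<open>Taking out -7 turns 21 and 35 into -3 and -5, and isqrt7^3 into
    \<open>isqrt7\<close>. All terms but the constant one keep a further factor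
    \<open>isqrt7\<close>.\<close>
  define W where "W = msc (of_int (- 3)) Y + msc (of_int (- 5) * isqrt7) (Y ** Y) + Z"
  have "W \<in> mats_O7"
    unfolding W_def using Y Z
    by (intro mats_O7_add mats_O7_msc mats_O7_mult O7_mult isqrt7_in_O7 O7_of_int)
  have "7 choose 2 = (21::nat)" "7 choose 3 = (35::nat)" by code_simp+
  then have "(\<Sum>i<7. upow A i) = msc (- 7) (mat (of_int (- 1)) + msc isqrt7 W)"
    unfolding Z(2) W_def isqrt7_sq
    by (simp add: vec_eq_iff mat_nth algebra_simps isqrt7_sq)
      (simp add: mult.assoc[symmetric] isqrt7_sq)
  then have "msc (- 7) ((mat (of_int (- 1)) + msc isqrt7 W) ** (A - mat 1)) = 0"
    using geometric_sum_matrix[of A 7] assms(3) by (simp add: msc_mult_left)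
  then have "(mat (of_int (- 1)) + msc isqrt7 W) ** (A - mat 1) = 0"
    by (simp add: vec_eq_iff)
  moreover have "res7 (of_int (- 1)) \<noteq> 0" unfolding res7_of_int by simp
  ultimately have "A - mat 1 = 0"
    using mult_eq_0_det_nz det_unit_mod7 O7_of_int \<open>W \<in> mats_O7\<close> by blast
  then show ?thesis by simp
qed

lemma red7_upow:
  assumes "A \<in> UO7" "red7 A = red7 (mat 1)"
  shows "red7 (upow A n) = red7 (mat 1)"
proof (induction n)
  case (Suc n)
  then have "red7 (upow A n ** A) = red7 (mat 1 ** mat 1)"
    using assms by (intro red7_UO7_mult_cong) (auto simp: UO7_mat_1 U.nat_pow_closed)
  then show ?case by simp
qed simp

text \<open>While 7 divides the exponent, \<open>torsion_7\<close> applied to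
  \<open>upow A m\<close> removes a factor 7; the coprime case ends the descent.\<close>

lemma torsion_trivial:
  assumes "A \<in> UO7" "red7 A = red7 (mat 1)" "upow A n = mat 1" "n > 0"
  shows "A = mat 1"
  using assms(3,4)
proof (induction n rule: less_induct)
  case (less n)
  show ?case
  proof (cases "7 dvd n")
    case True
    then obtain m where n: "n = m * 7" by (metis dvd_div_mult_self)
    then have "m > 0" "m < n" using less.prems by auto
    have "upow (upow A m) 7 = mat 1"
      using less.prems n U.nat_pow_pow[OF assms(1), of m 7] by simp
    then have "upow A m = mat 1"
      using torsion_7 assms U.nat_pow_closed red7_upow by blast
    then show ?thesis using less.IH \<open>m > 0\<close> \<open>m < n\<close> by blast
  qed (use torsion_coprime assms less.prems in blast)
qed

lemma torsion_free_Gamma0: "torsion_free PUJ_O7 Gamma0"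
  unfolding torsion_free_def
proof (intro ballI allI impI)
  fix h and n :: nat
  assume "h \<in> Gamma0" "n > 0" and hn: "h [^]\<^bsub>PUJ_O7\<^esub> n = \<one>\<^bsub>PUJ_O7\<^esub>"
  then obtain A where A: "A \<in> UO7" "h = cls A" "red7 A = red7 (mat 1)"
    unfolding Gamma0_eq by blast
  have "cls (upow A n) = cls (mat 1)"
    using hn cls.hom_nat_pow[OF A(1), of n] by (simp add: A(2) one_PUJ_O7)
  \<comment> \<open>Triviality in the quotient leaves a sign. The determinant excludes -1, because
    the dimension is odd.\<close>
  then have "upow A n = mat 1 \<or> upow A n = - mat 1"
    by (auto simp: cls_def doubleton_eq_iff)
  moreover have "det (upow A n) = 1"
    using UO7_red7_det[of "upow A n" "mat 1"] red7_upow A U.nat_pow_closed UO7_mat_1 by simp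
  moreover have "det (- mat 1 :: complex^3^3) = - 1"
    by (simp add: det_minus3)
  ultimately have "upow A n = mat 1" by auto
  then show "h = \<one>\<^bsub>PUJ_O7\<^esub>"
    using torsion_trivial A \<open>n > 0\<close> one_PUJ_O7 by blast
qed

section \<open>Parabolic elements\<close>

text \<open>The second elementary symmetric function of the eigenvalues.\<close>

definition minors2 :: "complex^3^3 \<Rightarrow> complex" where
  "minors2 A = A$1$1 * A$2$2 - A$1$2 * A$2$1 + (A$1$1 * A$3$3 - A$1$3 * A$3$1)
     + (A$2$2 * A$3$3 - A$2$3 * A$3$2)"

lemma trace_3: "trace A = A$1$1 + A$2$2 + A$3$3" for A :: "complex^3^3"
  by (simp add: trace_def sum_3)

lemma det_shift: "det (A - mat x) = det A - minors2 A * x + trace A * x\<^sup>2 - x ^ 3"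
  by (simp add: det_3 minors2_def trace_3 mat_nth power2_eq_square power3_eq_cube algebra_simps)

text \<open>The right-hand side is minus the derivative in \<open>x\<close> of the characteristic
  polynomial in \<open>det_shift\<close>, so a common zero of both is a multiple eigenvalue.\<close>

lemma minors2_shift: "minors2 (A - mat x) = minors2 A - 2 * trace A * x + 3 * x\<^sup>2"
  by (simp add: minors2_def trace_3 mat_nth power2_eq_square algebra_simps)

lemma cayley_hamilton_3:
  "A ** (A ** (A ** mat 1)) = msc (trace A) (A ** A) - msc (minors2 A) A + mat (det A)"
  for A :: "complex^3^3"
  by (simp add: vec_eq_iff forall_3 matrix_matrix_mult_def sum_3 det_3 minors2_def trace_3 mat_nth
      algebra_simps)

text \<open>The adjugate of \<open>M\<close> is a multiple of \<open>v l\<^sup>T\<close>, and \<open>minors2 M\<close> is its trace.\<close>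

lemma minors2_eq_0:
  fixes M :: "complex^3^3" and v l :: "complex^3"
  assumes Mv: "M *v v = 0" and lM: "l v* M = 0"
    and lv: "l$1 * v$1 + l$2 * v$2 + l$3 * v$3 = 0" and "v \<noteq> 0" "l \<noteq> 0"
  shows "minors2 M = 0"
proof -
  have r: "M$i$1 * v$1 + M$i$2 * v$2 + M$i$3 * v$3 = 0" for i
    using arg_cong[OF Mv, of "\<lambda>x. x $ i"] by (simp add: matrix_vector_mult_def sum_3)
  have c: "l$1 * M$1$j + l$2 * M$2$j + l$3 * M$3$j = 0" for j
    using arg_cong[OF lM, of "\<lambda>x. x $ j"]
    by (simp add: vector_matrix_mult_def sum_3 mult.commute)
  obtain k where k: "v $ k \<noteq> 0" using \<open>v \<noteq> 0\<close> by (auto simp: vec_eq_iff)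
  obtain m where m: "l $ m \<noteq> 0" using \<open>l \<noteq> 0\<close> by (auto simp: vec_eq_iff)
  define C :: "complex^3^3" where "C = vector
    [vector [M$2$2 * M$3$3 - M$2$3 * M$3$2, M$1$3 * M$3$2 - M$1$2 * M$3$3, M$1$2 * M$2$3 - M$1$3 * M$2$2],
     vector [M$2$3 * M$3$1 - M$2$1 * M$3$3, M$1$1 * M$3$3 - M$1$3 * M$3$1, M$1$3 * M$2$1 - M$1$1 * M$2$3],
     vector [M$2$1 * M$3$2 - M$2$2 * M$3$1, M$1$2 * M$3$1 - M$1$1 * M$3$2, M$1$1 * M$2$2 - M$1$2 * M$2$1]]"
  have "\<forall>i j k. v$k * C$i$j = v$i * C$k$j"
    unfolding forall_3 C_def vector_3
    by (insert r[of 1] r[of 2] r[of 3], intro conjI; (rule refl | algebra))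
  then have vC: "v$k * C$i$j = v$i * C$k$j" for i j k by blast
  have "\<forall>i j k. l$k * C$i$j = l$j * C$i$k"
    unfolding forall_3 C_def vector_3
    by (insert c[of 1] c[of 2] c[of 3], intro conjI; (rule refl | algebra))
  then have lC: "l$k * C$i$j = l$j * C$i$k" for i j k by blast
  \<comment> \<open>Both indices of a diagonal entry are moved to the fixed \<open>k\<close> and
    \<open>m\<close>, so that the trace of \<open>C\<close> becomes a multiple of the product of
    \<open>l\<close> and \<open>v\<close>.\<close>
  have tr: "v$k * l$m * C$i$i = (l$i * v$i) * C$k$m" for i
  proof -
    have "v$k * l$m * C$i$i = l$m * (v$i * C$k$i)" using vC[of k i i] by (simp add: mult_ac)
    also have "\<dots> = v$i * (l$i * C$k$m)" using lC[of m k i] by (simp add: mult_ac)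
    finally show ?thesis by (simp add: mult_ac)
  qed
  have "minors2 M = C$1$1 + C$2$2 + C$3$3" by (simp add: minors2_def C_def)
  then have "v$k * l$m * minors2 M = (l$1 * v$1 + l$2 * v$2 + l$3 * v$3) * C$k$m"
    by (simp only: distrib_left distrib_right tr)
  then have "v$k * l$m * minors2 M = 0" using lv by simp
  then show ?thesis using k m by simp
qed

text \<open>Each principal minor is \<open>det A\<close> times a diagonal entry of the inverse, and
  the inverse \<open>adjJ A\<close> has the conjugate trace.\<close>

lemma minors2_UJ:
  assumes "A \<in> UJ" shows "minors2 A = det A * cnj (trace A)"
proof -
  define B where "B = adjJ A"
  have "A ** B = mat 1" using assms UJ_iff_right B_def by simp
  then have e: "A$i$1 * B$1$j + A$i$2 * B$2$j + A$i$3 * B$3$j = (if i = j then 1 else 0)" for i j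
    by (simp add: vec_eq_iff matrix_matrix_mult_def sum_3 mat_nth)
  have "A$1$1 * A$2$2 - A$1$2 * A$2$1 = det A * B$3$3"
    using e[of 1 3] e[of 2 3] e[of 3 3] unfolding det_3 by simp algebra
  moreover have "A$1$1 * A$3$3 - A$1$3 * A$3$1 = det A * B$2$2"
    using e[of 1 2] e[of 2 2] e[of 3 2] unfolding det_3 by simp algebra
  moreover have "A$2$2 * A$3$3 - A$2$3 * A$3$2 = det A * B$1$1"
    using e[of 1 1] e[of 2 1] e[of 3 1] unfolding det_3 by simp algebra
  moreover have "cnj (trace A) = B$1$1 + B$2$2 + B$3$3"
    by (simp add: B_def adjJ_def trace_3)
  ultimately show ?thesis unfolding minors2_def by (simp add: algebra_simps)
qed

section \<open>Fixed lines, eigenvectors and the double eigenvalue\<close>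

lemma span_line: "vec.span {v} = range (\<lambda>c. c *s v)" for v :: "complex^3"
  by (simp add: vec.span_singleton)

lemma matrix_vector_scale: "A *v (c *s v) = c *s (A *v v)" for A :: "complex^3^3"
  by (simp add: vec_eq_iff matrix_vector_mult_def sum_distrib_left mult_ac)

lemma act_line_iff:
  assumes "A \<in> UJ" "v \<noteq> 0"
  shows "act (cls A) (vec.span {v}) = vec.span {v} \<longleftrightarrow> (\<exists>x. A *v v = x *s v)"
proof
  have "A *v v \<in> (\<lambda>w. A *v w) ` vec.span {v}"
    by (intro imageI vec.span_base) simp
  moreover assume "act (cls A) (vec.span {v}) = vec.span {v}"
  ultimately have "A *v v \<in> vec.span {v}" unfolding act_def cls_def by blast
  then show "\<exists>x. A *v v = x *s v" unfolding span_line by blast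
next
  assume "\<exists>x. A *v v = x *s v"
  then obtain x where x: "A *v v = x *s v" by blast
  \<comment> \<open>With eigenvalue 0 the line would collapse; invertibility of \<open>A\<close>
    prevents this.\<close>
  have "x \<noteq> 0"
  proof
    assume "x = 0"
    then have "adjJ A *v (A *v v) = 0" using x by simp
    then show False
      using assms UJ_iff_left by (simp add: matrix_vector_mul_assoc)
  qed
  have img: "(\<lambda>w. B *v w) ` vec.span {v} = vec.span {v}" if "B *v v = y *s v" "y \<noteq> 0" for B y
  proof -
    have "(\<lambda>w. B *v w) ` vec.span {v} = range (\<lambda>c. (c * y) *s v)"
      unfolding span_line image_image by (simp add: matrix_vector_scale that(1))
    also have "\<dots> = vec.span {v}"
    proof
      show "range (\<lambda>c. (c * y) *s v) \<subseteq> vec.span {v}" unfolding span_line by blast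
      show "vec.span {v} \<subseteq> range (\<lambda>c. (c * y) *s v)"
      proof
        fix w assume "w \<in> vec.span {v}"
        then obtain c where "w = c *s v" unfolding span_line by blast
        then have "w = ((c / y) * y) *s v" using that(2) by simp
        then show "w \<in> range (\<lambda>c. (c * y) *s v)" by blast
      qed
    qed
    finally show ?thesis .
  qed
  have "(- A) *v v = (- x) *s v"
    using x by (simp add: minus_matrix_vector_mult)
  then show "act (cls A) (vec.span {v}) = vec.span {v}"
    using img[OF x \<open>x \<noteq> 0\<close>] img[of "- A" "- x"] \<open>x \<noteq> 0\<close> unfolding act_def cls_def by simp
qed

lemma parabolic_fixed_null_line:
  assumes "A \<in> UJ" "parabolic (cls A)"
  obtains v x where "v \<noteq> 0" "herm v v = 0" "A *v v = x *s v"
    "\<And>w y. w \<noteq> 0 \<Longrightarrow> herm w w = 0 \<Longrightarrow> A *v w = y *s w \<Longrightarrow> \<exists>c. w = c *s v"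
proof -
  obtain L where L: "L \<in> boundary_H2C" "act (cls A) L = L"
    and uniq: "\<And>L'. L' \<in> boundary_H2C \<Longrightarrow> act (cls A) L' = L' \<Longrightarrow> L' = L"
  proof -
    have "\<exists>!L. L \<in> boundary_H2C \<and> act (cls A) L = L"
      using assms(2) unfolding parabolic_def by (rule conjunct2)
    then obtain L where L: "L \<in> boundary_H2C \<and> act (cls A) L = L"
        "\<forall>L'. L' \<in> boundary_H2C \<and> act (cls A) L' = L' \<longrightarrow> L' = L"
      by (rule ex1E)
    show ?thesis
      using L(2) by (intro that[OF conjunct1[OF L(1)] conjunct2[OF L(1)]]) iprover
  qed
  from L(1) obtain v where v: "L = vec.span {v}" "v \<noteq> 0" "herm v v = 0"
    unfolding boundary_H2C_def by blast
  then obtain x where x: "A *v v = x *s v"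
    using L(2) act_line_iff[OF assms(1)] by blast
  have "\<exists>c. w = c *s v" if w: "w \<noteq> 0" "herm w w = 0" "A *v w = y *s w" for w y
  proof -
    have "vec.span {w} \<in> boundary_H2C" unfolding boundary_H2C_def using w by blast
    then have "vec.span {w} = vec.span {v}"
      using uniq act_line_iff[OF assms(1) w(1)] w(3) v(1) by blast
    then have "w \<in> vec.span {v}" using vec.span_base[of w "{w}"] by simp
    then show ?thesis unfolding span_line by blast
  qed
  then show ?thesis using that v x by blast
qed

lemma matrix_diff_vector_mult: "(A - mat x) *v v = A *v v - x *s v" for A :: "complex^3^3"
  by (simp add: vec_eq_iff forall_3 matrix_vector_mult_def sum_3 mat_nth algebra_simps)

lemma matrix_axis_nth: "(B *v axis j 1) $ i = B $ i $ j" for B :: "complex^3^3"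
  using exhaust_3[of j] by (auto simp: matrix_vector_mult_def sum_3 axis_def)

lemma eigenvector_iff_det: "(\<exists>v. v \<noteq> 0 \<and> A *v v = x *s v) \<longleftrightarrow> det (A - mat x) = 0"
  for A :: "complex^3^3"
  using ex_kernel_iff_det[of "A - mat x"] by (simp add: matrix_diff_vector_mult)

lemma det_adjJ_shift: "det (adjJ A - mat x) = cnj (det (A - mat (cnj x)))"
proof -
  have "adjJ A - mat x = adjJ (A - mat (cnj x))"
    by (simp add: vec_eq_iff forall_3 adjJ_def mat_nth)
  then show ?thesis by (simp add: det_adjJ)
qed

text \<open>If the eigenvalue \<open>x\<close> on the fixed null line had \<open>\<bar>x\<bar> \<noteq> 1\<close>, an eigenvector for the eigenvalue
  \<open>1 / cnj x\<close> would span a second fixed null line.\<close>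

lemma parabolic_eigenvalue:
  assumes "A \<in> UJ" "parabolic (cls A)"
  obtains x where "x * cnj x = 1" "det (A - mat x) = 0" "minors2 (A - mat x) = 0"
proof -
  obtain v x where v: "v \<noteq> 0" "herm v v = 0" "A *v v = x *s v"
    and uniq: "\<And>w y. w \<noteq> 0 \<Longrightarrow> herm w w = 0 \<Longrightarrow> A *v w = y *s w \<Longrightarrow> \<exists>c. w = c *s v"
    using parabolic_fixed_null_line[OF assms] by blast
  have Av: "v = x *s (adjJ A *v v)"
  proof -
    have "adjJ A *v (A *v v) = v"
      using assms(1) UJ_iff_left by (simp add: matrix_vector_mul_assoc)
    then show ?thesis by (simp add: v(3) matrix_vector_scale)
  qed
  have "x \<noteq> 0" using Av v(1) by auto
  then have adj_v: "adjJ A *v v = inverse x *s v"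
    by (subst (2) Av) simp
  have x1: "x * cnj x = 1"
  proof (rule ccontr)
    assume nx: "x * cnj x \<noteq> 1"
    define y where "y = cnj (inverse x)"
    \<comment> \<open>The inverse of \<open>A\<close> has eigenvalue 1 / x and is also the adjoint,
      so the conjugate \<open>y\<close> is an eigenvalue of \<open>A\<close> itself.\<close>
    have "det (adjJ A - mat (inverse x)) = 0"
      using eigenvector_iff_det v(1) adj_v by blast
    then have "det (A - mat y) = 0" by (simp add: det_adjJ_shift y_def)
    then obtain w where w: "w \<noteq> 0" "A *v w = y *s w" using eigenvector_iff_det by blast
    have hw: "herm w w = herm (A *v w) (A *v w)" using UJ_herm[OF assms(1)] by simp
    have "herm w w = y * cnj y * herm w w"
      by (subst hw) (simp add: w(2) herm_scale_left herm_scale_right)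
    then have "herm w w * (1 - y * cnj y) = 0" by algebra
    moreover have "y * cnj y \<noteq> 1"
    proof -
      have "y * cnj y = inverse (x * cnj x)" by (simp add: y_def mult.commute)
      then show ?thesis using nx by (simp only: inverse_eq_1_iff not_False_eq_True)
    qed
    ultimately have "herm w w = 0" by auto
    \<comment> \<open>Uniqueness of the fixed null line makes \<open>w\<close> a multiple of
      \<open>v\<close>, so y = x and x cnj x = 1 after all.\<close>
    then obtain c where c: "w = c *s v" using uniq w by blast
    then have "A *v w = x *s w" by (simp add: matrix_vector_scale v(3) mult.commute)
    then have "y *s w = x *s w" using w(2) by simp
    then have "y = x" using w(1) by (simp add: vector_mul_rcancel)
    moreover have "y * cnj x = 1" using \<open>x \<noteq> 0\<close> by (simp add: y_def)
    ultimately show False using nx by simp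
  qed
  have "det (A - mat x) = 0" using eigenvector_iff_det v(1,3) by blast
  moreover have "minors2 (A - mat x) = 0"
  proof (rule minors2_eq_0)
    \<comment> \<open>The row vector of the functional herm(-, v). It is a left eigenvector for
      \<open>x\<close> since \<open>x\<close> has modulus 1, and it annihilates \<open>v\<close>
      since \<open>v\<close> is null.\<close>
    define l :: "complex^3" where "l = vector [cnj (v$3), cnj (v$2), cnj (v$1)]"
    have hl: "herm u v = l$1 * u$1 + l$2 * u$2 + l$3 * u$3" for u
      by (simp add: herm_eq l_def)
    show "(A - mat x) *v v = 0" by (simp add: matrix_diff_vector_mult v(3))
    show "v \<noteq> 0" by (rule v)
    show "l \<noteq> 0" using v(1) by (auto simp: l_def vec_eq_iff forall_3)
    show "l$1 * v$1 + l$2 * v$2 + l$3 * v$3 = 0" using v(2) hl by simp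
    show "l v* (A - mat x) = 0"
    proof -
      have "herm ((A - mat x) *v u) v = 0" for u
      proof -
        have "cnj (inverse x) = x" using inverse_unique[OF x1] by simp
        then have "herm (A *v u) v = x * herm u v"
          by (simp add: herm_adjJ adj_v herm_scale_right)
        then show ?thesis
          by (simp add: matrix_diff_vector_mult herm_diff_left herm_scale_left)
      qed
      then have "l$1 * ((A - mat x) *v u)$1 + l$2 * ((A - mat x) *v u)$2
          + l$3 * ((A - mat x) *v u)$3 = 0" for u
        by (simp only: hl)
      moreover have "(l v* B) $ j = l$1 * (B *v axis j 1)$1 + l$2 * (B *v axis j 1)$2
          + l$3 * (B *v axis j 1)$3" for B :: "complex^3^3" and j
        by (simp add: vector_matrix_mult_def sum_3 matrix_axis_nth mult.commute)
      ultimately show ?thesis by (simp only: vec_eq_iff zero_index) blast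
    qed
  qed
  ultimately show ?thesis using that x1 by blast
qed

text \<open>In the second alternative, \<open>t = (- 1 \<plusminus> i \<surd>7) / 2\<close>.\<close>

lemma O7_small_cong_3:
  assumes "t \<in> O7" "res7 t = 3" "cmod t \<le> 3"
  shows "t = 3 \<or> (t * t + t + 2 = 0 \<and> cnj t = - 1 - t)"
proof -
  obtain m n :: int where t: "t = of_int m + of_int n * omega7"
    using O7_E[OF assms(1)] by blast
  have "(cmod t)\<^sup>2 \<le> 3\<^sup>2" using assms(3) by (intro power_mono) auto
  then have "(of_int (m * m + m * n + 2 * n * n) :: real) \<le> of_int 9"
    unfolding norm_omega7_form[symmetric] t[symmetric] by simp
  then have le: "m * m + m * n + 2 * n * n \<le> 9" by (simp only: of_int_le_iff)
  define Q where "Q = m * m + m * n + 2 * n * n"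
  have "Q \<le> 9" using le by (simp only: Q_def)
  have bound: "x < 4" if "y * y + 7 * (x * x) \<le> 72" for x y :: int
  proof (rule ccontr)
    assume "\<not> x < 4"
    then have "4 * 4 \<le> x * x" by (intro mult_mono) auto
    then show False using that zero_le_square[of y] by linarith
  qed
  have bound3: "x < 3" if "y * y + 7 * (x * x) \<le> 36" for x y :: int
  proof (rule ccontr)
    assume "\<not> x < 3"
    then have "3 * 3 \<le> x * x" by (intro mult_mono) auto
    then show False using that zero_le_square[of y] by linarith
  qed
  \<comment> \<open>Completing the square in \<open>m\<close> here, and in \<open>n\<close> below,
    bounds \<open>n\<close> and then \<open>m\<close>, which leaves finitely many cases.\<close>
  have "(2 * m + n) * (2 * m + n) + 7 * (n * n) = 4 * Q" unfolding Q_def by algebra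
  then have "(2 * m + n) * (2 * m + n) + 7 * (n * n) \<le> 36" using \<open>Q \<le> 9\<close> by simp
  then have n: "n < 3" "- n < 3" using bound3[of "2 * m + n" n] bound3[of "2 * m + n" "- n"] by simp_all
  have "(4 * n + m) * (4 * n + m) + 7 * (m * m) = 8 * Q" unfolding Q_def by algebra
  then have "(4 * n + m) * (4 * n + m) + 7 * (m * m) \<le> 72" using \<open>Q \<le> 9\<close> by simp
  then have m: "m < 4" "- m < 4" using bound[of "4 * n + m" m] bound[of "4 * n + m" "- m"] by simp_all
  have "(m + 4 * n) mod 7 = 3" using assms(2) by (simp only: t res7_form)
  moreover have "n = -2 \<or> n = -1 \<or> n = 0 \<or> n = 1 \<or> n = 2" using n by linarith
  moreover have "m = -3 \<or> m = -2 \<or> m = -1 \<or> m = 0 \<or> m = 1 \<or> m = 2 \<or> m = 3"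
    using m by linarith
  ultimately have "(m = 3 \<and> n = 0) \<or> (m = -1 \<and> n = 1) \<or> (m = 0 \<and> n = -1)"
    using le by (elim disjE; simp)
  then consider "t = 3" | "t = omega7 - 1" | "t = - omega7"
    unfolding t by (elim disjE conjE) simp_all
  then show ?thesis
  proof cases
    case 2
    have "t * t + t + 2 = omega7 * omega7 - omega7 + 2" by (simp add: 2 algebra_simps)
    then show ?thesis by (simp add: omega7_sq 2 cnj_omega7)
  next
    case 3
    then show ?thesis by (simp add: omega7_sq cnj_omega7)
  qed simp
qed

text \<open>The two equations say that \<open>x\<close> is a multiple root of the characteristic
  polynomial of a unitary matrix with determinant 1 and trace \<open>t\<close>.\<close>

lemma double_eigenvalue_trace:
  fixes t x :: complex
  assumes "x * cnj x = 1" "1 - cnj t * x + t * x\<^sup>2 - x ^ 3 = 0" "cnj t - 2 * t * x + 3 * x\<^sup>2 = 0"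
    and t: "t \<in> O7" "res7 t = 3"
  shows "t = 3"
proof -
  \<comment> \<open>Adding \<open>x\<close> times the third assumption to the second eliminates
    \<open>cnj t\<close>.\<close>
  have eq: "t * x\<^sup>2 = 1 + 2 * x ^ 3" using assms(2,3) by algebra
  have "complex_of_real ((cmod x)\<^sup>2) = 1" using assms(1) by (simp only: complex_norm_square)
  then have "(cmod x)\<^sup>2 = 1" by (simp only: of_real_eq_1_iff)
  then have x: "cmod x = 1" using abs_square_eq_1[of "cmod x"] by simp
  have "cmod t = cmod (1 + 2 * x ^ 3)"
    unfolding eq[symmetric] by (simp add: norm_mult norm_power x)
  also have "\<dots> \<le> cmod 1 + cmod (2 * x ^ 3)" by (rule norm_triangle_ineq)
  also have "\<dots> = 3" by (simp add: norm_mult norm_power x)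
  finally consider "t = 3" | "t * t + t + 2 = 0" "cnj t = - 1 - t"
    using O7_small_cong_3 t by blast
  then show ?thesis
  proof cases
    case 2
    then have "3 * x\<^sup>2 - 2 * t * x - 1 - t = 0" using assms(3) unfolding 2(2) by algebra
    then have p: "3 * x\<^sup>2 = 2 * t * x + 1 + t" by algebra
    have r: "t * t = - t - 2" using 2(1) by algebra
    \<comment> \<open>Reduction by the quadratic relations \<open>p\<close> and \<open>r\<close>
      leaves an equation linear in \<open>x\<close>. Its solution x = t + 1/2 then contradicts
      \<open>p\<close>.\<close>
    have "3 * (t * (3 * x\<^sup>2) - 3) = 6 * x * (3 * x\<^sup>2)" using eq by algebra
    then have tx: "(4 * t + 2) * x = - 7" using p r by algebra
    have "(2 * t + 1) * (4 * t + 2) = - 14" using r by algebra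
    then have "- 14 * x = (2 * t + 1) * ((4 * t + 2) * x)" by (simp only: mult.assoc[symmetric])
    then have "- 7 * (2 * x) = - 7 * (2 * t + 1)" unfolding tx by simp
    then have x_t: "2 * x = 2 * t + 1" by (simp only: mult_cancel_left) simp
    have "3 * (2 * x)\<^sup>2 = 4 * (2 * x * t) + 4 + 4 * t" using p by algebra
    then have "3 * (4 * (t * t) + 4 * t + 1) = 8 * (t * t) + 8 * t + (4 :: complex)"
      unfolding x_t by algebra
    then have "- 21 = (- 12 :: complex)" unfolding r by simp
    then show ?thesis by simp
  qed
qed

lemma torsion_free_at_infinity_Gamma0: "torsion_free_at_infinity Gamma0"
  unfolding torsion_free_at_infinity_def
proof (intro ballI impI)
  fix h assume "h \<in> Gamma0" "parabolic h"
  then obtain A where A: "A \<in> UO7" "h = cls A" "red7 A = red7 (mat 1)"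
    unfolding Gamma0_eq by blast
  have UJ: "A \<in> UJ" and mats: "A \<in> mats_O7" using A(1) UO7_iff by auto
  obtain x where x: "x * cnj x = 1" "det (A - mat x) = 0" "minors2 (A - mat x) = 0"
    using parabolic_eigenvalue UJ \<open>parabolic h\<close> A(2) by blast
  have d: "det A = 1" using UO7_red7_det[OF A(1) UO7_mat_1 A(3)] by simp
  then have s: "minors2 A = cnj (trace A)" using minors2_UJ[OF UJ] by simp
  have "res7 (A $ i $ i) = 1" for i
    using arg_cong[OF A(3), of "\<lambda>M. M $ i $ i"] by (simp add: red7_def mat_nth)
  then have "trace A \<in> O7" "res7 (trace A) = 3"
    using mats_O7_nth[OF mats] by (simp_all add: trace_3 O7_add res7_add)
  then have t: "trace A = 3"
    using double_eigenvalue_trace[of x "trace A"] x by (simp add: det_shift minors2_shift d s)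
  \<comment> \<open>The characteristic polynomial of \<open>A\<close> is that of the identity, so
    all lower coefficients for \<open>N\<close> vanish and N^3 = 0.\<close>
  define N where "N = A - mat 1"
  have "trace N = trace A - 3" unfolding N_def by (simp add: trace_3 mat_nth)
  then have "trace N = 0" using t by simp
  moreover have "minors2 N = 0" "det N = 0"
    unfolding N_def minors2_shift det_shift by (simp_all add: s t d)
  ultimately have "N ** (N ** (N ** mat 1)) = 0"
    unfolding cayley_hamilton_3 by (simp add: vec_eq_iff mat_nth)
  then have "((\<lambda>B. (A - mat 1) ** B) ^^ 3) (mat 1) = 0"
    by (simp add: numeral_3_eq_3 N_def)
  then have "unipotent_mat A" unfolding unipotent_mat_def by blast
  then show "unipotent h" unfolding unipotent_def A(2) cls_def by blast
qed

section \<open>The index\<close>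

text \<open>The isotropic vectors of \<open>Jmat\<close> modulo 7, including zero, as a list so that
  the count can be evaluated.\<close>

definition null7 :: "(int \<times> int \<times> int) list" where
  "null7 = filter (\<lambda>(a, b, c). (2 * a * c + b * b) mod 7 = 0)
     (List.product [0..6] (List.product [0..6] [0..6]))"

fun bil7 :: "int \<times> int \<times> int \<Rightarrow> int \<times> int \<times> int \<Rightarrow> bool" where
  "bil7 (a, b, c) (d, e, f) \<longleftrightarrow> (a * f + b * e + c * d) mod 7 = 1"

definition pairs7 :: "((int \<times> int \<times> int) \<times> (int \<times> int \<times> int)) set" where
  "pairs7 = (SIGMA x : set null7. set (filter (bil7 x) null7))"

lemma null7_eq:
  "null7 = [
     (0, 0, 0), (0, 0, 1), (0, 0, 2), (0, 0, 3), (0, 0, 4), (0, 0, 5), (0, 0, 6),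
     (1, 0, 0), (1, 1, 3), (1, 2, 5), (1, 3, 6), (1, 4, 6), (1, 5, 5), (1, 6, 3),
     (2, 0, 0), (2, 1, 5), (2, 2, 6), (2, 3, 3), (2, 4, 3), (2, 5, 6), (2, 6, 5),
     (3, 0, 0), (3, 1, 1), (3, 2, 4), (3, 3, 2), (3, 4, 2), (3, 5, 4), (3, 6, 1),
     (4, 0, 0), (4, 1, 6), (4, 2, 3), (4, 3, 5), (4, 4, 5), (4, 5, 3), (4, 6, 6),
     (5, 0, 0), (5, 1, 2), (5, 2, 1), (5, 3, 4), (5, 4, 4), (5, 5, 1), (5, 6, 2),
     (6, 0, 0), (6, 1, 4), (6, 2, 2), (6, 3, 1), (6, 4, 1), (6, 5, 2), (6, 6, 4)]"
  by code_simp

text \<open>The evaluated number agrees with geometry: there are 8 isotropic lines, hence 48 nonzero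
  isotropic vectors, and each has product 1 with exactly one vector on each of the 7 other
  lines.\<close>

lemma card_pairs7: "card pairs7 = 336"
proof -
  have d: "distinct null7"
    unfolding null7_def by (intro distinct_filter distinct_product distinct_upto)
  then have "card (set (filter (bil7 x) null7)) = length (filter (bil7 x) null7)" for x
    by (intro distinct_card distinct_filter)
  moreover have "card pairs7 = (\<Sum>x\<in>set null7. card (set (filter (bil7 x) null7)))"
    unfolding pairs7_def by (rule card_SigmaI) simp_all
  ultimately have "card pairs7 = (\<Sum>x\<in>set null7. length (filter (bil7 x) null7))"
    by (simp only:)
  also have "\<dots> = sum_list (map (\<lambda>x. length (filter (bil7 x) null7)) null7)"
    using d by (simp only: sum_list_distinct_conv_sum_set)
  also have "\<dots> = 336"
    unfolding null7_eq by code_simp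
  finally show ?thesis .
qed

lemma in_pairs7:
  "((a, b, c), (d, e, f)) \<in> pairs7 \<longleftrightarrow>
     {a, b, c, d, e, f} \<subseteq> {0..6} \<and> (2 * a * c + b * b) mod 7 = 0 \<and> (2 * d * f + e * e) mod 7 = 0
     \<and> (a * f + b * e + c * d) mod 7 = 1"
  by (auto simp: pairs7_def null7_def)

text \<open>Since det (- A) = - det A, each class in the quotient has exactly one representative
  here.\<close>

definition SUO7 :: "(complex^3^3) set" where
  "SUO7 = {A \<in> UO7. det A = 1}"

lemma SUO7_mult: "A \<in> SUO7 \<Longrightarrow> B \<in> SUO7 \<Longrightarrow> A ** B \<in> SUO7"
  by (simp add: SUO7_def UO7_mult det_mul)

text \<open>The first and the third column modulo \<open>i \<surd>7\<close>; they determine the second column of a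
  matrix of determinant 1.\<close>

definition key :: "complex^3^3 \<Rightarrow> (int \<times> int \<times> int) \<times> (int \<times> int \<times> int)" where
  "key A = ((res7 (A$1$1), res7 (A$2$1), res7 (A$3$1)), (res7 (A$1$3), res7 (A$2$3), res7 (A$3$3)))"

text \<open>The two columns are images of the first and third basis vectors, which are null with
  product 1. Conjugation disappears under \<open>res7\<close>.\<close>

lemma key_in_pairs7:
  assumes "A \<in> SUO7" shows "key A \<in> pairs7"
proof -
  have UJ: "A \<in> UJ" and O7: "A $ i $ j \<in> O7" for i j
    using assms mats_O7_nth unfolding SUO7_def UO7_iff by blast+
  have col: "(A *v axis j 1) $ i = A $ i $ j" for i j by (rule matrix_axis_nth)
  have red: "res7 (x * cnj y + z * cnj w + u * cnj v) = (res7 x * res7 y + res7 z * res7 w + res7 u * res7 v) mod 7"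
    if "x \<in> O7" "y \<in> O7" "z \<in> O7" "w \<in> O7" "u \<in> O7" "v \<in> O7" for x y z w u v
    using that by (simp add: res7_add res7_mult res7_cnj O7_add O7_mult O7_cnj mod_simps)
  have h: "res7 (herm (axis i 1) (axis j 1)) = (res7 (A$3$i) * res7 (A$1$j) + res7 (A$2$i) * res7 (A$2$j)
      + res7 (A$1$i) * res7 (A$3$j)) mod 7" for i j
    using UJ_herm[OF UJ, of "axis i 1" "axis j 1", symmetric] red O7
    by (simp add: herm_eq[of "A *v v" "A *v w" for v w] col)
  have "res7 (herm (axis 1 1) (axis 1 1)) = 0" "res7 (herm (axis 3 1) (axis 3 1)) = 0"
    "res7 (herm (axis 1 1) (axis 3 1)) = 1"
    by (simp_all add: herm_eq axis_def)
  moreover have "0 \<le> res7 z" "res7 z \<le> 6" for z using res7_bounds[of z] by simp_all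
  ultimately show ?thesis
    unfolding key_def in_pairs7 h by (simp add: algebra_simps)
qed

text \<open>For determinant 1 the inverse is both the adjugate and \<open>adjJ A\<close>; the
  formulas compare their second rows.\<close>

lemma SUO7_column_2:
  assumes "A \<in> SUO7"
  shows "A$3$2 = cnj (A$2$3 * A$3$1 - A$2$1 * A$3$3)"
    "A$2$2 = cnj (A$1$1 * A$3$3 - A$1$3 * A$3$1)"
    "A$1$2 = cnj (A$1$3 * A$2$1 - A$1$1 * A$2$3)"
proof -
  define B where "B = adjJ A"
  have "A ** B = mat 1" and d: "det A = 1"
    using assms by (simp_all add: SUO7_def B_def adjJ_inverse)
  then have e: "A$i$1 * B$1$j + A$i$2 * B$2$j + A$i$3 * B$3$j = (if i = j then 1 else 0)" for i j
    by (simp add: vec_eq_iff matrix_matrix_mult_def sum_3 mat_nth)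
  have "A$2$3 * A$3$1 - A$2$1 * A$3$3 = B$2$1"
    using d e[of 1 1] e[of 2 1] e[of 3 1] unfolding det_3 by simp algebra
  moreover have "A$1$1 * A$3$3 - A$1$3 * A$3$1 = B$2$2"
    using d e[of 1 2] e[of 2 2] e[of 3 2] unfolding det_3 by simp algebra
  moreover have "A$1$3 * A$2$1 - A$1$1 * A$2$3 = B$2$3"
    using d e[of 1 3] e[of 2 3] e[of 3 3] unfolding det_3 by simp algebra
  ultimately show "A$3$2 = cnj (A$2$3 * A$3$1 - A$2$1 * A$3$3)"
    "A$2$2 = cnj (A$1$1 * A$3$3 - A$1$3 * A$3$1)"
    "A$1$2 = cnj (A$1$3 * A$2$1 - A$1$1 * A$2$3)"
    by (simp_all add: B_def adjJ_def)
qed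

lemma key_eq_iff:
  assumes "A \<in> SUO7" "B \<in> SUO7"
  shows "key A = key B \<longleftrightarrow> red7 A = red7 B"
proof
  assume "red7 A = red7 B"
  then have "res7 (A $ i $ j) = res7 (B $ i $ j)" for i j
    by (simp add: red7_def vec_eq_iff)
  then show "key A = key B" by (simp add: key_def)
next
  assume k: "key A = key B"
  have O7: "C $ i $ j \<in> O7" if "C \<in> SUO7" for C i j
    using that mats_O7_nth unfolding SUO7_def UO7_iff by blast
  have red: "res7 (cnj (x * y - z * w)) = (res7 x * res7 y - res7 z * res7 w) mod 7"
    if "x \<in> O7" "y \<in> O7" "z \<in> O7" "w \<in> O7" for x y z w
    using that by (simp add: res7_cnj res7_diff res7_mult O7_diff O7_mult O7_cnj mod_simps)
  have col2: "res7 (C$3$2) = (res7 (C$2$3) * res7 (C$3$1) - res7 (C$2$1) * res7 (C$3$3)) mod 7"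
    "res7 (C$2$2) = (res7 (C$1$1) * res7 (C$3$3) - res7 (C$1$3) * res7 (C$3$1)) mod 7"
    "res7 (C$1$2) = (res7 (C$1$3) * res7 (C$2$1) - res7 (C$1$1) * res7 (C$2$3)) mod 7"
    if "C \<in> SUO7" for C
    by (subst SUO7_column_2[OF that], rule red; rule O7[OF that])+
  show "red7 A = red7 B"
    using k col2[OF assms(1)] col2[OF assms(2)]
    by (simp add: red7_def vec_eq_iff forall_3 key_def)
qed

definition lifts :: "int^3^3 \<Rightarrow> bool" where
  "lifts M \<longleftrightarrow> (\<exists>A\<in>SUO7. \<forall>i j. res7 (A $ i $ j) = M $ i $ j mod 7)"

text \<open>Since \<open>lifts\<close> reads entries modulo 7, words in the generators can be
  multiplied over the integers.\<close>

lemma lifts_mult: "lifts M \<Longrightarrow> lifts N \<Longrightarrow> lifts (M ** N)"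
proof -
  assume "lifts M" "lifts N"
  then obtain A B where A: "A \<in> SUO7" "\<And>i j. res7 (A $ i $ j) = M $ i $ j mod 7"
    and B: "B \<in> SUO7" "\<And>i j. res7 (B $ i $ j) = N $ i $ j mod 7"
    unfolding lifts_def by blast
  then have mats: "A \<in> mats_O7" "B \<in> mats_O7" by (simp_all add: SUO7_def UO7_iff)
  have "res7 ((A ** B) $ i $ j) = (M ** N) $ i $ j mod 7" for i j
  proof -
    have "(\<Sum>k\<in>UNIV. (M $ i $ k mod 7) * (N $ k $ j mod 7)) mod 7 = (\<Sum>k\<in>UNIV. M $ i $ k * N $ k $ j) mod 7"
      unfolding sum_3 by (intro mod_add_cong mod_mult_cong mod_mod_trivial)
    then show ?thesis
      using red7_mult_nth[OF mats, of i j] by (simp only: red7_def matrix_matrix_mult_def vec_lambda_beta A(2) B(2))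
  qed
  then show ?thesis unfolding lifts_def using SUO7_mult[OF A(1) B(1)] by blast
qed

lemma lifts_cong:
  assumes "lifts M" "\<And>i j. M $ i $ j mod 7 = N $ i $ j mod 7" shows "lifts N"
  using assms unfolding lifts_def by simp

text \<open>The lift of a Heisenberg translation has the upper right entry \<open>(- z\<^sup>2 + z i \<surd>7) / 2\<close>.\<close>

definition heis7 :: "int \<Rightarrow> int^3^3" where
  "heis7 z = vector [vector [1, - z, 3 * z * z], vector [0, 1, z], vector [0, 0, 1]]"

text \<open>The sign gives determinant 1, as \<open>Jmat\<close> has determinant -1.\<close>

definition weyl7 :: "int^3^3" where
  "weyl7 = vector [vector [0, 0, - 1], vector [0, - 1, 0], vector [- 1, 0, 0]]"

definition torus7 :: "int \<Rightarrow> int \<Rightarrow> int^3^3" where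
  "torus7 a c = vector [vector [a, 0, 0], vector [0, 1, 0], vector [0, 0, c]]"

lemma SUO7_I: "adjJ A ** A = mat 1 \<Longrightarrow> A \<in> mats_O7 \<Longrightarrow> det A = 1 \<Longrightarrow> A \<in> SUO7"
  by (simp add: SUO7_def UO7_iff UJ_iff_left)

lemma lifts_heis7: "lifts (heis7 z)"
proof -
  \<comment> \<open>This choice makes \<open>w\<close> equal to (- z^2 + z isqrt7) / 2, so that w +
    cnj w = - z^2 as unitarity requires. Its residue is 3 z^2 because 3 is -1/2 modulo 7.\<close>
  define q where "q = z * (z + 1) div 2"
  have q: "2 * q = z * (z + 1)" unfolding q_def by simp
  define w where "w = of_int (- q) + of_int z * omega7"
  define A :: "complex^3^3" where
    "A = vector [vector [1, - of_int z, w], vector [0, 1, of_int z], vector [0, 0, 1]]"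
  have wq: "w + cnj w = - (of_int z * of_int z)"
  proof -
    have "w + cnj w = of_int (z - 2 * q)" by (simp add: w_def cnj_omega7 algebra_simps)
    also have "z - 2 * q = - (z * z)" using q by (simp add: algebra_simps)
    finally show ?thesis by simp
  qed
  then have "w + (cnj w + of_int z * of_int z) = 0" by (simp add: add.assoc[symmetric])
  then have "adjJ A ** A = mat 1"
    by (simp add: A_def adjJ_def vec_eq_iff forall_3 matrix_matrix_mult_def sum_3 mat_nth
        algebra_simps)
  moreover have "A \<in> mats_O7"
    unfolding mats_O7_def forall_3 A_def w_def vector_3 mem_Collect_eq
    by (intro conjI O7_closed O7_0 O7_1)
  moreover have "det A = 1" by (simp add: det_3 A_def)
  ultimately have "A \<in> SUO7" by (rule SUO7_I)
  moreover have "res7 w = 3 * z * z mod 7"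
  proof -
    have "- q + 4 * z = 3 * z * z + 7 * (z - q)"
      using q by (simp add: algebra_simps)
    then have "(- q + 4 * z) mod 7 = 3 * z * z mod 7" by (metis mod_mult_self2)
    then show ?thesis unfolding w_def by (simp only: res7_form)
  qed
  then have "\<forall>i j. res7 (A $ i $ j) = heis7 z $ i $ j mod 7"
    using res7_of_int[of "- z"] by (simp add: forall_3 A_def heis7_def res7_of_int)
  ultimately show ?thesis unfolding lifts_def by blast
qed

lemma lifts_weyl7: "lifts weyl7"
proof -
  have "- Jmat \<in> SUO7"
    by (intro SUO7_I)
      (simp_all add: adjJ_def vec_eq_iff forall_3 matrix_matrix_mult_def sum_3 mat_nth mats_O7_def
        det_3 O7_minus)
  moreover have "\<forall>i j. res7 ((- Jmat) $ i $ j) = weyl7 $ i $ j mod 7"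
    using res7_of_int[of "- 1"] by (simp add: forall_3 weyl7_def)
  ultimately show ?thesis unfolding lifts_def by blast
qed

lemma lifts_torus7_minus: "lifts (torus7 (- 1) (- 1))"
proof -
  define A :: "complex^3^3" where
    "A = vector [vector [- 1, 0, 0], vector [0, 1, 0], vector [0, 0, - 1]]"
  have "A \<in> SUO7"
    by (intro SUO7_I)
      (simp_all add: A_def adjJ_def vec_eq_iff forall_3 matrix_matrix_mult_def sum_3 mat_nth
        mats_O7_def det_3 O7_minus)
  moreover have "\<forall>i j. res7 (A $ i $ j) = torus7 (- 1) (- 1) $ i $ j mod 7"
    using res7_of_int[of "- 1"] by (simp add: forall_3 A_def torus7_def)
  ultimately show ?thesis unfolding lifts_def by blast
qed

text \<open>The units of \<open>O7\<close> are 1 and -1, so no diagonal lift exists. A word in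
  translations and the Weyl element reduces to this matrix instead.\<close>

lemma lifts_torus7_2: "lifts (torus7 2 4)"
proof (rule lifts_cong)
  show "lifts (heis7 2 ** weyl7 ** (heis7 1 ** weyl7) ** (heis7 2 ** weyl7))"
    by (intro lifts_mult lifts_heis7 lifts_weyl7)
  have "\<forall>i j. (heis7 2 ** weyl7 ** (heis7 1 ** weyl7) ** (heis7 2 ** weyl7)) $ i $ j mod 7
      = torus7 2 4 $ i $ j mod 7"
    unfolding forall_3 by (simp add: heis7_def weyl7_def torus7_def matrix_matrix_mult_def sum_3)
  then show "(heis7 2 ** weyl7 ** (heis7 1 ** weyl7) ** (heis7 2 ** weyl7)) $ i $ j mod 7
      = torus7 2 4 $ i $ j mod 7" for i j by blast
qed

lemma torus7_mult: "torus7 a c ** torus7 b d = torus7 (a * b) (c * d)"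
  by (simp add: torus7_def vec_eq_iff forall_3 matrix_matrix_mult_def sum_3)

lemma torus7_cong:
  "lifts (torus7 a c) \<Longrightarrow> a mod 7 = b mod 7 \<Longrightarrow> c mod 7 = d mod 7 \<Longrightarrow> lifts (torus7 b d)"
proof (rule lifts_cong[of "torus7 a c"])
  assume "a mod 7 = b mod 7" "c mod 7 = d mod 7"
  then have "\<forall>i j. torus7 a c $ i $ j mod 7 = torus7 b d $ i $ j mod 7"
    unfolding forall_3 by (simp add: torus7_def)
  then show "torus7 a c $ i $ j mod 7 = torus7 b d $ i $ j mod 7" for i j by blast
qed

lemma lifts_torus7:
  assumes "a * c mod 7 = 1" shows "lifts (torus7 a c)"
proof -
  \<comment> \<open>Powers of 2 and the sign produce all nonzero residues; each fact is named after
    the residue of its first entry.\<close>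
  have t4: "lifts (torus7 4 16)" using lifts_mult[OF lifts_torus7_2 lifts_torus7_2]
    by (simp add: torus7_mult)
  have t1: "lifts (torus7 8 64)" using lifts_mult[OF lifts_torus7_2 t4]
    by (simp add: torus7_mult)
  have t6: "lifts (torus7 (- 1) (- 1))" by (rule lifts_torus7_minus)
  have t5: "lifts (torus7 (- 2) (- 4))" using lifts_mult[OF lifts_torus7_2 t6]
    by (simp add: torus7_mult)
  have t3: "lifts (torus7 (- 4) (- 16))" using lifts_mult[OF t4 t6]
    by (simp add: torus7_mult)
  have "(a mod 7) * (c mod 7) mod 7 = 1" using assms by (simp add: mod_mult_eq)
  moreover have res: "x mod 7 = 0 \<or> x mod 7 = 1 \<or> x mod 7 = 2 \<or> x mod 7 = 3 \<or> x mod 7 = 4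
      \<or> x mod 7 = 5 \<or> x mod 7 = 6" for x :: int
    using pos_mod_bound[of 7 x] pos_mod_sign[of 7 x] by linarith
  ultimately have "(a mod 7, c mod 7) \<in> {(1, 1), (2, 4), (3, 5), (4, 2), (5, 3), (6, 6)}"
    using res[of a] res[of c] by (elim disjE) simp_all
  then show ?thesis
    using torus7_cong[OF t1, of a c] torus7_cong[OF lifts_torus7_2, of a c] torus7_cong[OF t3, of a c]
      torus7_cong[OF t4, of a c] torus7_cong[OF t5, of a c] torus7_cong[OF t6, of a c]
    by auto
qed

text \<open>Bruhat decomposition: the first column \<open>(a, b, c)\<close> lies in the big cell if \<open>c\<close> is not
  divisible by 7, and \<open>heis7 z ** weyl7 ** torus7 (- c) (- c') ** heis7 s\<close> with \<open>z = b / c\<close> and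
  \<open>s = z f - e\<close> has the prescribed columns.\<close>

lemma ex_lift:
  fixes a b c d e f :: int
  assumes "(2 * a * c + b * b) mod 7 = 0" "(2 * d * f + e * e) mod 7 = 0"
    "(a * f + b * e + c * d) mod 7 = 1"
  obtains M where "lifts M" "7 dvd M$1$1 - a" "7 dvd M$2$1 - b" "7 dvd M$3$1 - c"
    "7 dvd M$1$3 - d" "7 dvd M$2$3 - e" "7 dvd M$3$3 - f"
proof -
  obtain k1 where k1: "2 * a * c + b * b = 7 * k1" using assms(1) by (auto elim!: dvdE)
  obtain k2 where k2: "2 * d * f + e * e = 7 * k2" using assms(2) by (auto elim!: dvdE)
  define k3 where "k3 = (a * f + b * e + c * d) div 7"
  have k3: "a * f + b * e + c * d = 1 + 7 * k3"
    unfolding k3_def using assms(3) mult_div_mod_eq[of 7 "a * f + b * e + c * d"] by linarith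
  show ?thesis
  proof (cases "7 dvd c")
    case True
    then obtain g where g: "c = 7 * g" by blast
    have "7 dvd b * b" using k1 g by (metis dvd_add_right_iff dvd_triv_left mult.left_commute)
    then have "7 dvd b" using prime_dvd_mult_iff[of "7::int" b b] by simp
    then obtain h where h: "b = 7 * h" by blast
    define q where "q = k3 - h * e - g * d"
    have q: "a * f = 1 + 7 * q" using k3 g h by (simp add: q_def algebra_simps)
    \<comment> \<open>The upper triangular cell: here \<open>f\<close> inverts \<open>a\<close>, and
      isotropy of the third column determines \<open>d\<close> as 3 a e^2 modulo 7.\<close>
    define M where "M = torus7 a f ** heis7 e"
    have "a * f mod 7 = 1" by (simp add: q)
    then have "lifts M" unfolding M_def by (intro lifts_mult lifts_torus7 lifts_heis7)
    moreover have M: "M$1$1 = a" "M$2$1 = 0" "M$3$1 = 0" "M$1$3 = a * (3 * e * e)" "M$2$3 = e" "M$3$3 = f"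
      by (simp_all add: M_def torus7_def heis7_def matrix_matrix_mult_def sum_3)
    moreover have "a * (3 * e * e) - d = 7 * (3 * a * k2 - d - 6 * d * q)"
      using k2 q by algebra
    then have "7 dvd a * (3 * e * e) - d" by (rule dvdI)
    ultimately show ?thesis
      using g h by (intro that[of M]) simp_all
  next
    case False
    then have "coprime c 7"
      using prime_imp_coprime[of "7::int" c] by (simp add: coprime_commute)
    then obtain c' v where "c' * c + v * 7 = 1" using bezout_int[of c 7] by auto
    moreover define m where "m = - v"
    ultimately have m: "c * c' = 1 + 7 * m" by (simp add: algebra_simps)
    define z where "z = b * c'"
    define s where "s = z * f - e"
    define M where "M = heis7 z ** weyl7 ** torus7 (- c) (- c') ** heis7 s"
    have "(- c) * (- c') mod 7 = 1" by (simp add: m)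
    then have "lifts M" unfolding M_def by (intro lifts_mult lifts_torus7 lifts_heis7 lifts_weyl7)
    moreover have M: "M$1$1 = 3 * z * z * c" "M$2$1 = z * c" "M$3$1 = c"
        "M$1$3 = c' + z * s + 9 * c * z * z * s * s" "M$2$3 = - s + 3 * c * z * s * s" "M$3$3 = 3 * c * s * s"
      by (simp_all add: M_def torus7_def heis7_def weyl7_def matrix_matrix_mult_def sum_3 algebra_simps)
    \<comment> \<open>The numbers \<open>g\<close>, \<open>h\<close> and \<open>p\<close> are
      explicit quotients by 7. They witness isotropy of the first column, product 1, and isotropy of
      the third column, each rewritten in terms of \<open>z\<close> and \<open>s\<close>.\<close>
    moreover define g where "g = a - 3 * c' * c' * c * k1 + 6 * a * m * (c * c' + 1)"
    have g: "a - 3 * z * z * c = 7 * g"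
      unfolding z_def g_def using k1 m by algebra
    then have "3 * z * z * c - a = 7 * (- g)" by simp
    moreover have "z * c - b = 7 * (b * m)"
      unfolding z_def using m by algebra
    moreover define h where "h = k3 * c' - m * d - g * c' * f - 3 * m * z * z * f"
    have h: "d - c' + 3 * z * z * f + z * e = 7 * h"
    proof -
      have "d * (c * c') = c' * (1 + 7 * k3) - a * f * c' - z * e" unfolding z_def using k3 by algebra
      moreover have "3 * z * z * (c * c') * f - a * c' * f = - 7 * g * c' * f" using g by algebra
      ultimately show ?thesis unfolding m h_def by algebra
    qed
    moreover define p where "p = 3 * c * (k2 - 2 * h * f + z * z * f * f) - 6 * m * f - f"
    have p: "3 * c * s * s - f = 7 * p"
    proof -
      have "s * s = 7 * k2 - 14 * h * f - 2 * c' * f + 7 * z * z * f * f"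
        unfolding s_def using k2 h by algebra
      then show ?thesis unfolding p_def using m by algebra
    qed
    moreover have "- s + 3 * c * z * s * s - e = 7 * (z * p)"
      unfolding s_def[symmetric] using p s_def by algebra
    moreover have "c' + z * s + 9 * c * z * z * s * s - d = 7 * (z * z * f + 3 * z * z * p - h)"
      using p h s_def by algebra
    ultimately show ?thesis
      by (intro that[of M]) (simp_all only: M dvd_triv_left diff_self dvd_0_right)
  qed
qed

lemma key_image: "key ` SUO7 = pairs7"
proof
  show "key ` SUO7 \<subseteq> pairs7" using key_in_pairs7 by blast
  show "pairs7 \<subseteq> key ` SUO7"
  proof
    fix x assume x: "x \<in> pairs7"
    obtain a b c d e f where abc: "x = ((a, b, c), (d, e, f))" by (metis surj_pair)
    have bounds: "{a, b, c, d, e, f} \<subseteq> {0..6}" using x unfolding abc in_pairs7 by blast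
    obtain M where M: "lifts M" "7 dvd M$1$1 - a" "7 dvd M$2$1 - b" "7 dvd M$3$1 - c"
      "7 dvd M$1$3 - d" "7 dvd M$2$3 - e" "7 dvd M$3$3 - f"
      using x ex_lift unfolding abc in_pairs7 by metis
    obtain A where A: "A \<in> SUO7" "\<And>i j. res7 (A $ i $ j) = M $ i $ j mod 7"
      using M(1) unfolding lifts_def by blast
    have "res7 (A $ i $ j) = y" if "7 dvd M $ i $ j - y" "y \<in> {0..6}" for i j y
      using that A(2)[of i j] mod_eq_dvd_iff[of "M $ i $ j" 7 y] by simp
    then have "key A = x" unfolding key_def abc using M bounds by simp
    then show "x \<in> key ` SUO7" using A(1) by blast
  qed
qed

text \<open>Cosets agree when the quotient of the representatives lies in \<open>Gamma0\<close>.
  Determinant 1 settles the sign, so this compares reductions, which the keys determine.\<close>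

lemma rcoset_eq_iff:
  assumes "A \<in> SUO7" "B \<in> SUO7"
  shows "Gamma0 #>\<^bsub>PUJ_O7\<^esub> cls A = Gamma0 #>\<^bsub>PUJ_O7\<^esub> cls B \<longleftrightarrow> key A = key B"
proof -
  have U: "A \<in> UO7" "B \<in> UO7" and dets: "det A = 1" "det B = 1"
    using assms by (simp_all add: SUO7_def)
  have sub: "Gamma0 \<subseteq> carrier PUJ_O7" using subgroup_Gamma0 by (rule subgroup.subset)
  have AB: "A ** adjJ B \<in> UO7" using U by (intro UO7_mult UO7_adjJ)
  have carr: "cls A \<in> carrier PUJ_O7" "cls B \<in> carrier PUJ_O7" "cls (A ** adjJ B) \<in> carrier PUJ_O7"
    using U AB by (simp_all add: carrier_PUJ_O7)
  have quot: "cls A \<otimes>\<^bsub>PUJ_O7\<^esub> inv\<^bsub>PUJ_O7\<^esub> cls B = cls (A ** adjJ B)"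
    using U by (simp add: cls_inv cls_mult UO7_adjJ)
  have "Gamma0 #>\<^bsub>PUJ_O7\<^esub> cls A = Gamma0 #>\<^bsub>PUJ_O7\<^esub> cls B \<longleftrightarrow>
      Gamma0 #>\<^bsub>PUJ_O7\<^esub> cls (A ** adjJ B) = Gamma0"
    using P.coset_mult_inv1[OF _ carr(1,2) sub] P.coset_mult_inv2[OF _ carr(1,2) sub] quot by auto
  also have "\<dots> \<longleftrightarrow> cls (A ** adjJ B) \<in> Gamma0"
    using P.coset_join1[OF _ carr(3) subgroup_Gamma0] P.coset_join2[OF carr(3) subgroup_Gamma0] by blast
  also have "\<dots> \<longleftrightarrow> red7 (A ** adjJ B) = red7 (mat 1)"
  proof
    assume "cls (A ** adjJ B) \<in> Gamma0"
    then obtain C where C: "C \<in> UO7" "cls (A ** adjJ B) = cls C" "red7 C = red7 (mat 1)"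
      unfolding Gamma0_eq by blast
    then have "A ** adjJ B = C \<or> A ** adjJ B = - C" by (auto simp: cls_def doubleton_eq_iff)
    moreover have "det C = 1" using UO7_red7_det[OF C(1) UO7_mat_1 C(3)] by simp
    moreover have "det (A ** adjJ B) = 1" by (simp add: det_mul det_adjJ dets)
    ultimately have "A ** adjJ B = C" by (auto simp: det_minus3)
    then show "red7 (A ** adjJ B) = red7 (mat 1)" using C(3) by simp
  qed (use AB Gamma0_eq in blast)
  also have "\<dots> \<longleftrightarrow> key A = key B"
    using red7_mult_adjJ_iff[OF U] key_eq_iff[OF assms] by simp
  finally show ?thesis .
qed

section \<open>Counting cosets by their keys\<close>

lemma card_image_eq:
  assumes "\<And>x y. x \<in> S \<Longrightarrow> y \<in> S \<Longrightarrow> f x = f y \<longleftrightarrow> g x = g y"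
  shows "card (f ` S) = card (g ` S)"
proof (rule bij_betw_same_card)
  have inv: "inv_into S f (f x) \<in> S" "f (inv_into S f (f x)) = f x" if "x \<in> S" for x
    using that by (simp_all add: inv_into_into f_inv_into_f)
  have g: "g (inv_into S f (f x)) = g x" if "x \<in> S" for x
    using assms inv that by blast
  show "bij_betw (g \<circ> inv_into S f) (f ` S) (g ` S)"
    unfolding bij_betw_def inj_on_def using g assms by (auto simp: image_image)
qed

lemma card_rcosets_Gamma0: "card (rcosets\<^bsub>PUJ_O7\<^esub> Gamma0) = 336"
proof -
  have "cls ` UO7 = cls ` SUO7"
  proof
    show "cls ` SUO7 \<subseteq> cls ` UO7" unfolding SUO7_def by blast
    show "cls ` UO7 \<subseteq> cls ` SUO7"
    proof
      fix X assume "X \<in> cls ` UO7"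
      then obtain A where A: "A \<in> UO7" "X = cls A" by blast
      \<comment> \<open>Changing the sign of the representative makes its determinant 1 without
        changing the class.\<close>
      have "det A = 1 \<or> det (- A) = 1" using det_UO7[OF A(1)] by (auto simp: det_minus3)
      then have "A \<in> SUO7 \<or> - A \<in> SUO7" using A(1) UO7_minus by (auto simp: SUO7_def)
      moreover have "cls (- A) = X" using A(2) by (auto simp: cls_def)
      ultimately show "X \<in> cls ` SUO7" using A(2) by blast
    qed
  qed
  then have "rcosets\<^bsub>PUJ_O7\<^esub> Gamma0 = (\<lambda>A. Gamma0 #>\<^bsub>PUJ_O7\<^esub> cls A) ` SUO7"
    unfolding RCOSETS_def carrier_PUJ_O7 by auto
  then have "card (rcosets\<^bsub>PUJ_O7\<^esub> Gamma0) = card (key ` SUO7)"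
    using card_image_eq[of SUO7 "\<lambda>A. Gamma0 #>\<^bsub>PUJ_O7\<^esub> cls A" key] rcoset_eq_iff by simp
  then show ?thesis by (simp add: key_image card_pairs7)
qed

theorem proposition7p1:
  shows "subgroup Gamma0 PUJ_O7
    \<and> torsion_free PUJ_O7 Gamma0
    \<and> card (rcosets\<^bsub>PUJ_O7\<^esub> Gamma0) = 336
    \<and> torsion_free_at_infinity Gamma0"
  using subgroup_Gamma0 torsion_free_Gamma0 card_rcosets_Gamma0 torsion_free_at_infinity_Gamma0
  by blast

end
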